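(* Let $G=G_2(q)$ with $q\geqslant 3$ a prime power, and let $H$ be a maximal subgroup of $G$ which is a maximal rank subgroup of type $\mathrm{L}_2(q)\times\mathrm{L}_2(q)$. Then $b(G,H)=2$.
   Context: Let $\bar G=G_2(k)$, with $k$ the algebraic closure of $\mathbb{F}_q$, and let $\sigma$ be a Frobenius morphism with $\bar G_\sigma=G=G_2(q)$. A maximal rank subgroup of $G$ of type $\mathrm{L}_2(q)\times\mathrm{L}_2(q)$ is a subgroup $H=\bar H_\sigma$, where $\bar H=A_1\tilde A_1$ is a $\sigma$-stable maximal rank subgroup of $\bar G$ conjugate to the subgroup generated by the root subgroups for $\pm(3a+2b)$ and $\pm a$ ($a$ a short and $b$ a long simple root). For $q$ even $H\cong\mathrm{L}_2(q)\times\mathrm{L}_2(q)$; for $q$ odd $H=C_G(x)$ for an involution $x\in G$. The base size $b(G,H)$ is the minimal size of a subset $S\subseteq G$ with $\bigcap_{s\in S}H^s=\bigcap_{s\in G}H^s$ (which equals $1$ here). *)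

theory Defs
  imports
    "HOL-Analysis.Cartesian_Space"
    "HOL-Algebra.Generated_Groups"
    "HOL-Computational_Algebra.Computational_Algebra"
begin

section \<open>A Chevalley basis of the Lie algebra of type G2 in its 7-dimensional module\<close>

text \<open>
  The pair \<open>(i, j)\<close> stands for the root \<open>i a + j b\<close>, where \<open>a\<close> is the short and \<open>b\<close> the long
  simple root.
\<close>

definition g2_roots :: "(int \<times> int) set" where
  "g2_roots = {(1, 0), (0, 1), (1, 1), (2, 1), (3, 1), (3, 2),
               (-1, 0), (0, -1), (-1, -1), (-2, -1), (-3, -1), (-3, -2)}"

definition munit :: "7 \<Rightarrow> 7 \<Rightarrow> 'a::zero \<Rightarrow> 'a^7^7" where
  "munit i j c = (\<chi> k l. if k = i \<and> l = j then c else 0)"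

text \<open>
  Root vectors of a Chevalley basis, as integral matrices acting on column vectors in the
  7-dimensional module with weights \<open>2a+b, a+b, a, 0, -a, -a-b, -2a-b\<close> (in this order).
  The vectors for the simple roots and their negatives are fixed first; the remaining ones are
  determined by \<open>[e_a, e_b] = e_{a+b}\<close>, \<open>[e_a, e_{a+b}] = 2 e_{2a+b}\<close>,
  \<open>[e_a, e_{2a+b}] = 3 e_{3a+b}\<close>, \<open>[e_b, e_{3a+b}] = e_{3a+2b}\<close>, and by the condition that
  \<open>[e_r, e_{-r}]\<close> be the coroot of \<open>r\<close>. These relations are verified below. The index
  type \<open>7\<close> is the ring of integers modulo 7, so the index written \<open>7\<close> is its element \<open>0\<close>.
\<close>

definition chev_e :: "int \<times> int \<Rightarrow> int^7^7" where
  "chev_e r = (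
    if r = (1, 0) then munit 1 2 1 + munit 3 4 2 + munit 4 5 1 + munit 6 7 1
    else if r = (0, 1) then munit 2 3 1 + munit 5 6 1
    else if r = (1, 1) then munit 1 3 1 + munit 2 4 (-2) + munit 4 6 1 + munit 5 7 (-1)
    else if r = (2, 1) then munit 1 4 (-2) + munit 2 5 1 + munit 3 6 1 + munit 4 7 (-1)
    else if r = (3, 1) then munit 1 5 1 + munit 3 7 (-1)
    else if r = (3, 2) then munit 1 6 (-1) + munit 2 7 (-1)
    else if r = (-1, 0) then munit 2 1 1 + munit 4 3 1 + munit 5 4 2 + munit 7 6 1
    else if r = (0, -1) then munit 3 2 1 + munit 6 5 1
    else if r = (-1, -1) then munit 3 1 1 + munit 4 2 (-1) + munit 6 4 2 + munit 7 5 (-1)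
    else if r = (-2, -1) then munit 4 1 (-1) + munit 5 2 1 + munit 6 3 1 + munit 7 4 (-2)
    else if r = (-3, -1) then munit 5 1 1 + munit 7 3 (-1)
    else if r = (-3, -2) then munit 6 1 (-1) + munit 7 2 (-1)
    else 0)"

definition lie :: "'a::comm_ring_1^'n^'n \<Rightarrow> 'a^'n^'n \<Rightarrow> 'a^'n^'n" where
  "lie A B = A ** B - B ** A"

lemma exhaust_7:
  fixes x :: 7
  shows "x = 1 \<or> x = 2 \<or> x = 3 \<or> x = 4 \<or> x = 5 \<or> x = 6 \<or> x = 7"
proof (induct x)
  case (of_int z)
  then have "z = 0 \<or> z = 1 \<or> z = 2 \<or> z = 3 \<or> z = 4 \<or> z = 5 \<or> z = 6" by fastforce
  then show ?case by auto
qed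

lemma forall_7: "(\<forall>i::7. P i) \<longleftrightarrow> P 1 \<and> P 2 \<and> P 3 \<and> P 4 \<and> P 5 \<and> P 6 \<and> P 7"
  by (metis exhaust_7)

lemma UNIV_7: "UNIV = {1, 2, 3, 4, 5, 6, 7::7}"
  using exhaust_7 by auto

lemma sum_7: "sum f (UNIV :: 7 set) = f 1 + f 2 + f 3 + f 4 + f 5 + f 6 + f 7"
  unfolding UNIV_7 by (simp add: ac_simps)

lemma munit_mult:
  fixes c d :: "'a::semiring_1"
  shows "munit i j c ** munit k l d = (if j = k then munit i l (c * d) else 0)"
  by (auto simp: munit_def matrix_matrix_mult_def vec_eq_iff if_distrib[of "\<lambda>x. x * _"]
        if_distrib[of "\<lambda>x. _ * x"] sum.delta cong: if_cong)

lemma matrix_mult_zero: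
  "0 ** A = (0 :: 'a::semiring_1^'n^'n)" "A ** 0 = (0 :: 'a::semiring_1^'n^'n)"
  by (simp_all add: matrix_matrix_mult_def vec_eq_iff)

lemma matrix_add_rdistrib': "(A + B) ** C = A ** C + B ** (C :: 'a::semiring_1^'n^'n)"
  by (simp add: matrix_matrix_mult_def vec_eq_iff sum.distrib algebra_simps)

lemmas munit_calc = munit_mult matrix_add_rdistrib' matrix_add_ldistrib matrix_mult_zero

lemmas munit_entries = vec_eq_iff forall_7 munit_def mat_def

text \<open>
  The value of the root \<open>s\<close> on the coroot of \<open>r\<close> is \<open>2 (s, r) / (r, r)\<close>, for the invariant
  form with \<open>(a, a) = 2\<close>, \<open>(b, b) = 6\<close>, \<open>(a, b) = -3\<close>.
\<close>

definition g2_form :: "int \<times> int \<Rightarrow> int \<times> int \<Rightarrow> int" where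
  "g2_form r s = 2 * fst r * fst s + 6 * snd r * snd s - 3 * (fst r * snd s + snd r * fst s)"

lemma chev_coroot_a:
  "lie (chev_e (1, 0)) (chev_e (-1, 0)) = munit 1 1 1 + munit 2 2 (-1) + munit 3 3 2
     + munit 5 5 (-2) + munit 6 6 1 + munit 7 7 (-1)"
  by (simp add: chev_e_def munit_calc lie_def) (simp add: munit_entries)

lemma chev_coroot_b:
  "lie (chev_e (0, 1)) (chev_e (0, -1)) = munit 2 2 1 + munit 3 3 (-1)
     + munit 5 5 1 + munit 6 6 (-1)"
  by (simp add: chev_e_def munit_calc lie_def) (simp add: munit_entries)

lemma chev_weights:
  assumes "r \<in> {(1, 0), (0, 1)}" "s \<in> g2_roots"
  shows "lie (lie (chev_e r) (chev_e (- r))) (chev_e s)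
           = (\<chi> i j. (2 * g2_form s r div g2_form r r) * chev_e s $ i $ j)"
  using assms unfolding g2_roots_def
  by (elim insertE; simp add: chev_coroot_a chev_coroot_b g2_form_def;
      simp add: chev_e_def munit_calc lie_def; simp add: munit_entries)

lemma chev_coroot:
  assumes "s \<in> g2_roots"
  shows "lie (chev_e s) (chev_e (- s))
           = (\<chi> i j. (2 * fst s * lie (chev_e (1, 0)) (chev_e (-1, 0)) $ i $ j
                + 6 * snd s * lie (chev_e (0, 1)) (chev_e (0, -1)) $ i $ j) div g2_form s s)"
  using assms unfolding g2_roots_def
  by (elim insertE; simp add: chev_coroot_a chev_coroot_b g2_form_def;
      simp add: chev_e_def munit_calc lie_def; simp add: munit_entries)

lemma chev_brackets:
  "lie (chev_e (1, 0)) (chev_e (0, -1)) = 0"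
  "lie (chev_e (0, 1)) (chev_e (-1, 0)) = 0"
  "lie (chev_e (1, 0)) (chev_e (0, 1)) = chev_e (1, 1)"
  "lie (chev_e (1, 0)) (chev_e (1, 1)) = chev_e (2, 1) + chev_e (2, 1)"
  "lie (chev_e (1, 0)) (chev_e (2, 1)) = chev_e (3, 1) + chev_e (3, 1) + chev_e (3, 1)"
  "lie (chev_e (0, 1)) (chev_e (3, 1)) = chev_e (3, 2)"
  by (simp add: chev_e_def munit_calc lie_def; simp add: munit_entries)+


section \<open>Root elements\<close>

text \<open>
  \<open>x_r(t) = exp (t e_r)\<close>, formed from the divided powers \<open>e_r^n / n!\<close>. These are integral, so
  the division is exact and the formula makes sense over any field; they vanish for \<open>n \<ge> 3\<close>.
\<close>

definition x_root :: "int \<times> int \<Rightarrow> 'a::field \<Rightarrow> 'a^7^7" where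
  "x_root r t = (\<chi> i j. \<Sum>n<7. of_int ((((**) (chev_e r)) ^^ n) (mat 1) $ i $ j div fact n) * t ^ n)"

lemma chev_divided_powers:
  assumes "r \<in> g2_roots"
  shows "fact n dvd (((**) (chev_e r)) ^^ n) (mat 1) $ i $ j"
    and "n \<ge> 3 \<Longrightarrow> (((**) (chev_e r)) ^^ n) (mat 1) = 0"
proof -
  have cube: "chev_e r ** (chev_e r ** chev_e r) = 0"
    using assms unfolding g2_roots_def
    by (elim insertE; simp add: chev_e_def munit_calc)
  have vanish: "(((**) (chev_e r)) ^^ (m + 3)) (mat 1) = 0" for m
    by (induction m) (simp_all add: numeral_3_eq_3 cube matrix_mult_zero)
  show nilp: "n \<ge> 3 \<Longrightarrow> (((**) (chev_e r)) ^^ n) (mat 1) = 0" for n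
    using vanish[of "n - 3"] by simp
  have even: "\<forall>i j. 2 dvd (chev_e r ** chev_e r) $ i $ j"
    using assms unfolding g2_roots_def
    by (elim insertE; simp add: chev_e_def munit_calc; simp add: munit_def)
  consider "n = 0" | "n = 1" | "n = 2" | "n \<ge> 3" by linarith
  then show "fact n dvd (((**) (chev_e r)) ^^ n) (mat 1) $ i $ j"
  proof cases
    case 3
    then show ?thesis using even by (simp add: numeral_2_eq_2)
  next
    case 4
    then show ?thesis by (simp add: nilp)
  qed simp_all
qed

lemma x_root_eq:
  assumes "r \<in> g2_roots"
  shows "x_root r t = (\<chi> i j. (if i = j then 1 else 0) + of_int (chev_e r $ i $ j) * t
                          + of_int ((chev_e r ** chev_e r) $ i $ j div 2) * t^2)"
proof -
  have "{..<7::nat} = {0, 1, 2, 3, 4, 5, 6}" by auto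
  then show ?thesis
    using chev_divided_powers(2)[OF assms]
    by (simp add: x_root_def vec_eq_iff numeral_2_eq_2) (simp add: mat_def)
qed

lemma x_root_add:
  assumes "r \<in> g2_roots"
  shows "x_root r s ** x_root r t = x_root r (s + t)"
  using assms unfolding x_root_eq[OF assms] g2_roots_def
  by (elim insertE; simp add: chev_e_def munit_calc;
      simp add: vec_eq_iff forall_7 matrix_matrix_mult_def sum_7 munit_def;
      simp add: algebra_simps power2_eq_square)

lemma x_root_0:
  assumes "r \<in> g2_roots"
  shows "x_root r 0 = mat 1"
  using assms by (simp add: x_root_eq mat_def)


section \<open>The groups\<close>

definition GL :: "('a::field^'n^'n) monoid" where
  "GL = \<lparr>carrier = {A. invertible A}, monoid.mult = (**), one = mat 1\<rparr>"

text \<open>The algebraic group \<open>G_2(k)\<close>, as the Chevalley group of type G2 over \<open>k\<close>.\<close>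

definition G2_bar :: "('k::field^7^7) set" where
  "G2_bar = generate GL (\<Union>r\<in>g2_roots. range (x_root r))"

text \<open>
  The Frobenius morphism \<open>\<sigma>\<close>, sending \<open>x_r(t)\<close> to \<open>x_r(t^q)\<close>, and its group of fixed points
  \<open>G_2(q)\<close>.
\<close>

definition frob :: "nat \<Rightarrow> 'k::field^7^7 \<Rightarrow> 'k^7^7" where
  "frob q A = (\<chi> i j. (A $ i $ j) ^ q)"

definition G2 :: "nat \<Rightarrow> ('k::field^7^7) monoid" where
  "G2 q = GL\<lparr>carrier := {g \<in> G2_bar. frob q g = g}\<rparr>"

text \<open>The conjugate \<open>H^g = g^{-1} H g\<close>.\<close>

definition conjugate_set :: "('a, 'b) monoid_scheme \<Rightarrow> 'a set \<Rightarrow> 'a \<Rightarrow> 'a set" where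
  "conjugate_set G H g = (\<lambda>h. inv\<^bsub>G\<^esub> g \<otimes>\<^bsub>G\<^esub> h \<otimes>\<^bsub>G\<^esub> g) ` H"

definition A1A1_bar :: "('k::field^7^7) set" where
  "A1A1_bar = generate GL (\<Union>r\<in>{(3, 2), (-3, -2), (1, 0), (-1, 0)}. range (x_root r))"

text \<open>Maximal rank subgroups of \<open>G_2(q)\<close> of type \<open>L_2(q) \<times> L_2(q)\<close>.\<close>

definition max_rank_A1A1 :: "nat \<Rightarrow> ('k::field^7^7) set \<Rightarrow> bool" where
  "max_rank_A1A1 q H \<longleftrightarrow>
     (\<exists>Hbar. (\<exists>g\<in>G2_bar. Hbar = conjugate_set GL A1A1_bar g) \<and>
             frob q ` Hbar = Hbar \<and> H = {h \<in> Hbar. frob q h = h})"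

definition maximal_subgroup :: "'a set \<Rightarrow> ('a, 'b) monoid_scheme \<Rightarrow> bool" where
  "maximal_subgroup H G \<longleftrightarrow> subgroup H G \<and> H \<noteq> carrier G \<and>
     (\<forall>K. subgroup K G \<longrightarrow> H \<subseteq> K \<longrightarrow> K = H \<or> K = carrier G)"

text \<open>
  The intersection of the conjugates \<open>H^s\<close> for \<open>s \<in> S\<close> is taken inside \<open>G\<close>, so that it is \<open>G\<close>
  if \<open>S\<close> is empty.
\<close>

definition conj_Inter :: "('a, 'b) monoid_scheme \<Rightarrow> 'a set \<Rightarrow> 'a set \<Rightarrow> 'a set" where
  "conj_Inter G H S = {x \<in> carrier G. \<forall>s\<in>S. x \<in> conjugate_set G H s}"

definition base_size :: "('a, 'b) monoid_scheme \<Rightarrow> 'a set \<Rightarrow> nat" where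
  "base_size G H = (LEAST n. \<exists>S. S \<subseteq> carrier G \<and> finite S \<and> card S = n \<and>
                       conj_Inter G H S = conj_Inter G H (carrier G))"

text \<open>
  An algebraically closed field is an algebraic closure of \<open>F_q\<close> if every element is a root of
  a nonzero polynomial with coefficients in the subfield \<open>F_q = {c. c^q = c}\<close>.
\<close>

definition algebraic_over_Fq :: "nat \<Rightarrow> 'k::field \<Rightarrow> bool" where
  "algebraic_over_Fq q x \<longleftrightarrow>
     (\<exists>f :: 'k poly. f \<noteq> 0 \<and> (\<forall>i. coeff f i ^ q = coeff f i) \<and> poly f x = 0)"


lemma GL_simps [simp]:
  "carrier GL = {A. invertible A}" "x \<otimes>\<^bsub>GL\<^esub> y = x ** y" "\<one>\<^bsub>GL\<^esub> = mat 1"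
  by (simp_all add: GL_def)

lemma group_GL: "group (GL :: ('a::field^'n^'n) monoid)"
proof (rule groupI)
  show "\<And>x. x \<in> carrier (GL :: ('a^'n^'n) monoid) \<Longrightarrow> \<exists>y\<in>carrier GL. y \<otimes>\<^bsub>GL\<^esub> x = \<one>\<^bsub>GL\<^esub>"
    unfolding GL_simps invertible_def by blast
qed (auto simp: invertible_mult matrix_mul_assoc invertible_def[of "mat 1"])

lemma x_root_invertible:
  assumes "r \<in> g2_roots"
  shows "invertible (x_root r t)"
  unfolding invertible_def
  by (rule exI[of _ "x_root r (- t)"]) (simp add: x_root_add x_root_0 assms)

lemma subgroup_G2_bar: "subgroup G2_bar (GL :: ('k::field^7^7) monoid)"
  unfolding G2_bar_def by (rule group.generate_is_subgroup[OF group_GL]) (auto simp: x_root_invertible)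

lemma subgroup_A1A1_bar: "subgroup A1A1_bar (GL :: ('k::field^7^7) monoid)"
  unfolding A1A1_bar_def
  by (rule group.generate_is_subgroup[OF group_GL]) (auto simp: x_root_invertible g2_roots_def)

lemma frob_mult:
  fixes A B :: "'k::field^7^7"
  assumes "prime CHAR('k)" "q = CHAR('k) ^ n"
  shows "frob q (A ** B) = frob q A ** frob q B"
  by (simp add: frob_def vec_eq_iff matrix_matrix_mult_def power_mult_distrib
        freshmans_dream_sum'[OF assms])

lemma frob_one:
  assumes "q > 0"
  shows "frob q (mat 1 :: 'k::field^7^7) = mat 1"
  using assms by (simp add: frob_def vec_eq_iff mat_def)

lemma of_int_power_CHAR:
  assumes "prime CHAR('k::field)" "q = CHAR('k) ^ n"
  shows "(of_int z :: 'k) ^ q = of_int z"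
proof (induction z rule: int_induct[of _ 0])
  case base
  then show ?case using assms by (simp add: power_0_left prime_gt_0_nat)
next
  case (step1 z)
  then show ?case by (simp add: freshmans_dream'[OF assms])
next
  case (step2 z)
  have "(of_int z :: 'k) ^ q = (of_int (z - 1) + 1) ^ q" by simp
  also have "\<dots> = of_int (z - 1) ^ q + 1 ^ q" by (rule freshmans_dream'[OF assms])
  finally show ?case using step2 by (simp add: algebra_simps)
qed

lemma frob_x_root:
  assumes "prime CHAR('k)" "q = CHAR('k) ^ n"
  shows "frob q (x_root r t) = x_root r ((t :: 'k::field) ^ q)"
  by (simp add: frob_def x_root_def vec_eq_iff freshmans_dream_sum'[OF assms] power_mult_distrib
        of_int_power_CHAR[OF assms] power_mult[symmetric] mult.commute)

lemma subgroup_fixed_points: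
  assumes "prime CHAR('k::field)" "q = CHAR('k) ^ n"
  shows "subgroup {g \<in> G2_bar. frob q g = g} (GL :: ('k^7^7) monoid)"
proof -
  interpret GL: group "GL :: ('k^7^7) monoid" by (rule group_GL)
  interpret Gb: subgroup G2_bar "GL :: ('k^7^7) monoid" by (rule subgroup_G2_bar)
  have q: "q > 0" using assms by (simp add: prime_gt_0_nat)
  show ?thesis
  proof (rule GL.subgroupI)
    show "{g \<in> G2_bar. frob q g = g} \<subseteq> carrier (GL :: ('k^7^7) monoid)"
      using Gb.subset by blast
    show "{g \<in> G2_bar. frob q g = (g :: 'k^7^7)} \<noteq> {}"
      using Gb.one_closed frob_one[OF q] by auto
  next
    fix a :: "'k^7^7" assume a: "a \<in> {g \<in> G2_bar. frob q g = g}"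
    have ac: "a \<in> carrier GL" "inv\<^bsub>GL\<^esub> a \<in> G2_bar" using a Gb.subset by blast+
    have "inv\<^bsub>GL\<^esub> a ** a = mat 1" "a ** inv\<^bsub>GL\<^esub> a = mat 1"
      using GL.l_inv[of a] GL.r_inv[of a] ac by auto
    then have "frob q (inv\<^bsub>GL\<^esub> a ** a) = mat 1" "frob q (a ** inv\<^bsub>GL\<^esub> a) = mat 1"
      by (simp_all add: frob_one[OF q])
    then have "frob q (inv\<^bsub>GL\<^esub> a) ** a = mat 1" "a ** frob q (inv\<^bsub>GL\<^esub> a) = mat 1"
      using a by (simp_all add: frob_mult[OF assms])
    moreover from this have "invertible (frob q (inv\<^bsub>GL\<^esub> a))" unfolding invertible_def by blast
    ultimately have "frob q (inv\<^bsub>GL\<^esub> a) = inv\<^bsub>GL\<^esub> a"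
      using GL.inv_equality[of "frob q (inv\<^bsub>GL\<^esub> a)" a] ac by simp
    then show "inv\<^bsub>GL\<^esub> a \<in> {g \<in> G2_bar. frob q g = g}" using ac by simp
  next
    fix a b :: "'k^7^7"
    assume "a \<in> {g \<in> G2_bar. frob q g = g}" "b \<in> {g \<in> G2_bar. frob q g = g}"
    then show "a \<otimes>\<^bsub>GL\<^esub> b \<in> {g \<in> G2_bar. frob q g = g}"
      using Gb.m_closed[of a b] by (simp add: frob_mult[OF assms])
  qed
qed

lemma group_G2:
  assumes "prime CHAR('k::field)" "q = CHAR('k) ^ n"
  shows "group (G2 q :: ('k^7^7) monoid)"
  unfolding G2_def by (rule subgroup.subgroup_is_group[OF subgroup_fixed_points[OF assms] group_GL])

end

theory Submission
  imports Defs "HOL-Analysis.Determinants"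
begin

text \<open>
  It is enough to find \<open>s \<in> G\<close> with \<open>H \<inter> H^s = 1\<close>: the core of \<open>H\<close> is then trivial and is the
  intersection for the pair \<open>{1, s}\<close>, while the empty intersection \<open>G\<close> and the single conjugates of
  \<open>H\<close> are nontrivial because \<open>H \<noteq> 1\<close> (\<open>base_size_eq_2\<close>).

  The algebraic subgroup \<open>K = A1A1_bar\<close> is the image \<open>phi_SL2\<close> of the explicit homomorphism
  \<open>phi : SL_2 \<times> SL_2 \<rightarrow> GL_7\<close> whose module is the sum of the tensor product of the two natural
  modules (on \<open>W4\<close>, coordinates 1, 2, 6, 7) and a form of the symmetric square of the second one
  (on \<open>W3\<close>, coordinates 3, 4, 5). In the language of octonions, \<open>K\<close> is the stabilizer of a
  quaternion subalgebra, of which \<open>W3\<close> is the space of trace zero elements.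

  Every \<open>\<sigma>\<close>-stable conjugate of \<open>K\<close> is conjugate to \<open>K\<close> by an element of \<open>G\<close>
  (\<open>max_rank_A1A1_conjugate\<close>). This is the usual consequence of Lang's theorem for the connected
  group \<open>K\<close> together with \<open>N(K) = K\<close>. For \<open>SL_2\<close>, Lang's theorem reduces to solving two
  polynomial equations in one variable (\<open>lang_SL2\<close>). For the normalizer
  (\<open>phi_SL2_self_normalizing\<close>), an element that normalizes \<open>K\<close> preserves the decomposition
  \<open>W4 \<oplus> W3\<close>, because the two projections are the only nontrivial idempotents commuting with \<open>K\<close>;
  it also preserves the quadratic form and the alternating trilinear form that are invariant under
  \<open>G_2(k)\<close>. The quadratic form makes it act on \<open>W3\<close> like an element of \<open>K\<close> up to sign, and the
  trilinear form removes the sign and determines its action on \<open>W4\<close> up to the other factor of \<open>K\<close>.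

  It remains to find one \<open>g \<in> G\<close> with \<open>K \<inter> K^g = 1\<close>, even over the algebraically closed field.
  In odd characteristic \<open>K\<close> is the centralizer of the involution \<open>t\<close> that is 1 on \<open>W3\<close> and -1 on
  \<open>W4\<close>. The short root \<open>a + b\<close> and the long root \<open>-b\<close> form a base of the root system, and \<open>t\<close>
  inverts both root subgroups. If \<open>g\<close> is the product of the corresponding root elements, the
  product of \<open>t\<close> and its conjugate by \<open>g\<close> is a regular unipotent element, so that \<open>K \<inter> K^g\<close> lies
  in a small unipotent group. This motivates the choice of \<open>g\<close>; that the intersection is trivial is
  read off from the vanishing of the off-diagonal blocks of \<open>g phi(A, B) g^{-1}\<close>, which forces
  \<open>A = B = \<plusminus>1\<close> (\<open>separating_odd\<close>). In characteristic 2 the same \<open>g\<close> leaves a one-dimensional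
  unipotent intersection, and another product of root elements is used (\<open>separating_even\<close>).
  As all parameters of the root elements are 1, these products lie in \<open>G\<close> for every \<open>q\<close>.
\<close>

(* With two meanings of the dollar sign, iterated components are ambiguous, and a term with many
   matrix entries has exponentially many parses. *)
no_notation fps_nth (infixl "$" 75)

section \<open>The subgroup as an image of pairs of 2 by 2 matrices\<close>

definition vec7 :: "'a \<Rightarrow> 'a \<Rightarrow> 'a \<Rightarrow> 'a \<Rightarrow> 'a \<Rightarrow> 'a \<Rightarrow> 'a \<Rightarrow> 'a^7" where
  "vec7 a b c d e f g = (\<chi> i. if i = 1 then a else if i = 2 then b else if i = 3 then c
     else if i = 4 then d else if i = 5 then e else if i = 6 then f else g)"

lemma vec7_nth [simp]:
  "vec7 a b c d e f g $ 1 = a" "vec7 a b c d e f g $ 2 = b" "vec7 a b c d e f g $ 3 = c"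
  "vec7 a b c d e f g $ 4 = d" "vec7 a b c d e f g $ 5 = e" "vec7 a b c d e f g $ 6 = f"
  "vec7 a b c d e f g $ 7 = g" "vec7 a b c d e f g $ 0 = g"
  by (simp_all add: vec7_def)

definition mat2 :: "'a \<Rightarrow> 'a \<Rightarrow> 'a \<Rightarrow> 'a \<Rightarrow> 'a^2^2" where
  "mat2 a b c d = (\<chi> i j. if i = 1 then (if j = 1 then a else b) else (if j = 1 then c else d))"

lemma mat2_nth [simp]:
  "mat2 a b c d $ 1 $ 1 = a" "mat2 a b c d $ 1 $ 2 = b"
  "mat2 a b c d $ 2 $ 1 = c" "mat2 a b c d $ 2 $ 2 = d"
  by (simp_all add: mat2_def)

lemma mat2_cases: obtains a b c d where "A = mat2 a b c d"
proof
  show "A = mat2 (A$1$1) (A$1$2) (A$2$1) (A$2$2)"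
    by (simp add: vec_eq_iff forall_2)
qed

lemma mat2_mult: "mat2 a b c d ** mat2 a' b' c' d' =
  (mat2 (a*a'+b*c') (a*b'+b*d') (c*a'+d*c') (c*b'+d*d') :: 'a::semiring_1^2^2)"
  by (simp add: vec_eq_iff forall_2 matrix_matrix_mult_def sum_2)

lemma mat2_eq_iff [simp]: "mat2 a b c d = mat2 a' b' c' d' \<longleftrightarrow> a = a' \<and> b = b' \<and> c = c' \<and> d = d'"
  by (metis mat2_nth)

lemma mat_1_eq_mat2: "mat 1 = mat2 1 0 0 1"
  by (simp add: vec_eq_iff forall_2 mat_def)

text \<open>
  The first argument acts through the root subgroups of \<open>\<plusminus>(3a + 2b)\<close>, the second one through those
  of \<open>\<plusminus>a\<close>. The signs come from the signs in \<open>chev_e (3, 2)\<close>. The middle block is the symmetric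
  square in the basis \<open>x^2, 2xy, y^2\<close> rather than \<open>x^2, xy, y^2\<close>, hence the twos in its middle
  column; in characteristic 2 its middle basis vector is fixed.
\<close>
definition phi :: "'k::comm_ring_1^2^2 \<Rightarrow> 'k^2^2 \<Rightarrow> 'k^7^7" where
  "phi A B =
     vec7 (vec7 (A$1$1*B$1$1) (A$1$1*B$1$2) 0 0 0 (-(A$1$2*B$1$1)) (-(A$1$2*B$1$2)))
          (vec7 (A$1$1*B$2$1) (A$1$1*B$2$2) 0 0 0 (-(A$1$2*B$2$1)) (-(A$1$2*B$2$2)))
          (vec7 0 0 ((B$1$1)^2) (2*B$1$1*B$1$2) ((B$1$2)^2) 0 0)
          (vec7 0 0 (B$1$1*B$2$1) (B$1$1*B$2$2 + B$1$2*B$2$1) (B$1$2*B$2$2) 0 0)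
          (vec7 0 0 ((B$2$1)^2) (2*B$2$1*B$2$2) ((B$2$2)^2) 0 0)
          (vec7 (-(A$2$1*B$1$1)) (-(A$2$1*B$1$2)) 0 0 0 (A$2$2*B$1$1) (A$2$2*B$1$2))
          (vec7 (-(A$2$1*B$2$1)) (-(A$2$1*B$2$2)) 0 0 0 (A$2$2*B$2$1) (A$2$2*B$2$2))"

lemma phi_mat2:
  "phi (mat2 a b c d) (mat2 e f g h) =
     vec7 (vec7 (a*e) (a*f) 0 0 0 (-(b*e)) (-(b*f)))
          (vec7 (a*g) (a*h) 0 0 0 (-(b*g)) (-(b*h)))
          (vec7 0 0 (e^2) (2*e*f) (f^2) 0 0)
          (vec7 0 0 (e*g) (e*h+f*g) (f*h) 0 0)
          (vec7 0 0 (g^2) (2*g*h) (h^2) 0 0)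
          (vec7 (-(c*e)) (-(c*f)) 0 0 0 (d*e) (d*f))
          (vec7 (-(c*g)) (-(c*h)) 0 0 0 (d*g) (d*h))"
  by (simp add: phi_def)

lemma phi_mult: "phi A B ** phi C D = phi (A ** C) (B ** D)"
proof -
  obtain a b c d where A: "A = mat2 a b c d" by (rule mat2_cases)
  obtain e f g h where B: "B = mat2 e f g h" by (rule mat2_cases)
  obtain a' b' c' d' where C: "C = mat2 a' b' c' d'" by (rule mat2_cases)
  obtain e' f' g' h' where D: "D = mat2 e' f' g' h'" by (rule mat2_cases)
  show ?thesis
    unfolding A B C D mat2_mult phi_mat2
    by (simp add: vec_eq_iff forall_7 matrix_matrix_mult_def sum_7 algebra_simps power2_eq_square)
qed

lemma phi_one: "phi (mat 1) (mat 1) = mat 1"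
  by (simp add: mat_1_eq_mat2 phi_mat2 vec_eq_iff forall_7) (simp add: mat_def)

lemma x_root_phi:
  "x_root (1, 0) t = phi (mat 1) (mat2 1 t 0 1)"
  "x_root (-1, 0) t = phi (mat 1) (mat2 1 0 t 1)"
  "x_root (3, 2) t = phi (mat2 1 t 0 1) (mat 1)"
  "x_root (-3, -2) t = phi (mat2 1 0 t 1) (mat 1)"
  by (simp_all add: x_root_eq g2_roots_def mat_1_eq_mat2 phi_mat2 vec_eq_iff forall_7)
    (simp_all add: chev_e_def munit_calc, simp_all add: munit_def)

lemma det_mat2: "det (mat2 a b c d) = a * d - b * (c :: 'a::comm_ring_1)"
  by (simp add: det_2)

text \<open>
  Elementary matrices generate \<open>SL_2\<close>: a matrix with nonzero lower left entry is a product of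
  three of them, and a lower elementary factor makes this entry nonzero if it was zero.
\<close>
lemma SL2_induct:
  fixes A :: "'k::field^2^2"
  assumes "det A = 1"
    and upper: "\<And>t. P (mat2 1 t 0 1)" and lower: "\<And>t. P (mat2 1 0 t 1)"
    and mult: "\<And>A B. P A \<Longrightarrow> P B \<Longrightarrow> P (A ** B)"
  shows "P A"
proof -
  have nz: "P (mat2 a b c d)" if "a * d - b * c = 1" "c \<noteq> 0" for a b c d
  proof -
    have "mat2 a b c d = mat2 1 ((a - 1) / c) 0 1 ** mat2 1 0 c 1 ** mat2 1 ((d - 1) / c) 0 1"
      using that by (simp add: mat2_mult field_simps)
    then show ?thesis by (simp only:) (intro mult upper lower)
  qed
  obtain a b c d where A: "A = mat2 a b c d" by (rule mat2_cases)
  have det: "a * d - b * c = 1" using assms(1) by (simp add: A det_mat2)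
  show ?thesis
  proof (cases "c = 0")
    case True
    then have "P (mat2 (a + b) b (c + d) d)"
      using det by (intro nz) (auto simp: algebra_simps)
    then have "P (mat2 (a + b) b (c + d) d ** mat2 1 0 (- 1) 1)" by (intro mult lower)
    then show ?thesis by (simp add: mat2_mult A)
  next
    case False
    then show ?thesis using nz det by (simp add: A)
  qed
qed

lemma mat2_inverse:
  fixes A :: "'k::comm_ring_1^2^2"
  assumes "det A = 1"
  obtains A' where "det A' = 1" "A ** A' = mat 1" "A' ** A = mat 1"
proof -
  obtain a b c d where A: "A = mat2 a b c d" by (rule mat2_cases)
  have "a * d - b * c = 1" using assms by (simp add: A det_mat2)
  then show ?thesis
    by (intro that[of "mat2 d (-b) (-c) a"]) (simp_all add: A mat2_mult det_mat2 mat_1_eq_mat2 algebra_simps)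
qed

lemma inv_GL_eq:
  assumes "A ** B = (mat 1 :: 'k::field^'n^'n)"
  shows "inv\<^bsub>GL\<^esub> A = B"
proof -
  have "B ** A = mat 1" using assms by (simp add: matrix_left_right_inverse)
  then show ?thesis
    using assms by (intro group.inv_equality[OF group_GL]) (auto simp: invertible_def)
qed

definition phi_SL2 :: "('k::field^7^7) set" where
  "phi_SL2 = {phi A B | A B. det A = 1 \<and> det B = 1}"

lemma phi_SL2_I: "det A = 1 \<Longrightarrow> det B = 1 \<Longrightarrow> phi A B \<in> phi_SL2"
  by (auto simp: phi_SL2_def)

lemma subgroup_phi_SL2: "subgroup (phi_SL2 :: ('k::field^7^7) set) GL"
proof (rule group.subgroupI[OF group_GL])
  have inverse: "\<exists>h'\<in>phi_SL2. h ** h' = mat 1 \<and> h' ** h = mat 1" if h_in: "h \<in> phi_SL2" for h :: "'k^7^7"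
  proof -
    obtain A B where h: "h = phi A B" and det: "det A = 1" "det B = 1"
      using h_in by (auto simp: phi_SL2_def)
    obtain A' where A': "det A' = 1" "A ** A' = mat 1" "A' ** A = mat 1"
      by (rule mat2_inverse[OF det(1)])
    obtain B' where B': "det B' = 1" "B ** B' = mat 1" "B' ** B = mat 1"
      by (rule mat2_inverse[OF det(2)])
    show ?thesis
      using A' B' by (intro bexI[of _ "phi A' B'"]) (simp_all add: h phi_mult phi_one phi_SL2_I)
  qed
  show "(phi_SL2 :: ('k^7^7) set) \<subseteq> carrier GL"
    using inverse by (auto simp: invertible_def)
  have "phi (mat 1) (mat 1) \<in> (phi_SL2 :: ('k^7^7) set)" by (intro phi_SL2_I) auto
  then show "(phi_SL2 :: ('k^7^7) set) \<noteq> {}" by blast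
  show "inv\<^bsub>GL\<^esub> h \<in> phi_SL2" if "h \<in> phi_SL2" for h :: "'k^7^7"
    using inverse[OF that] inv_GL_eq by metis
  show "h \<otimes>\<^bsub>GL\<^esub> h' \<in> phi_SL2" if "h \<in> phi_SL2" "h' \<in> phi_SL2" for h h' :: "'k^7^7"
    using that unfolding phi_SL2_def by (auto simp: phi_mult det_mul) (metis det_mul mult_1)
qed

lemma A1A1_bar_eq: "A1A1_bar = (phi_SL2 :: ('k::field^7^7) set)"
proof
  have "(\<Union>r\<in>{(3, 2), (-3, -2), (1, 0), (-1, 0)}. range (x_root r)) \<subseteq> (phi_SL2 :: ('k^7^7) set)"
    by (auto simp: x_root_phi det_mat2 intro!: phi_SL2_I)
  then show "A1A1_bar \<subseteq> (phi_SL2 :: ('k^7^7) set)"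
    unfolding A1A1_bar_def by (intro group.generate_subgroup_incl[OF group_GL] subgroup_phi_SL2)
next
  interpret A1A1: subgroup "A1A1_bar :: ('k^7^7) set" GL by (rule subgroup_A1A1_bar)
  have gens: "x_root r t \<in> A1A1_bar" if "r \<in> {(3, 2), (-3, -2), (1, 0), (-1, 0)}" for r and t :: 'k
    unfolding A1A1_bar_def using that by (intro generate.incl) auto
  have mult: "x ** y \<in> A1A1_bar" if "x \<in> A1A1_bar" "y \<in> A1A1_bar" for x y :: "'k^7^7"
    using A1A1.m_closed[OF that] by simp
  have long: "phi A (mat 1) \<in> A1A1_bar" if "det A = 1" for A :: "'k^2^2"
    using that
  proof (rule SL2_induct)
    show "phi (mat2 1 t 0 1) (mat 1) \<in> A1A1_bar" "phi (mat2 1 0 t 1) (mat 1) \<in> A1A1_bar" for t :: 'k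
      using gens[of "(3, 2)" t] gens[of "(-3, -2)" t] by (simp_all add: x_root_phi)
    show "phi (A ** B) (mat 1) \<in> A1A1_bar"
      if "phi A (mat 1) \<in> A1A1_bar" "phi B (mat 1) \<in> A1A1_bar" for A B :: "'k^2^2"
      using mult[OF that] by (simp add: phi_mult)
  qed
  have short: "phi (mat 1) B \<in> A1A1_bar" if "det B = 1" for B :: "'k^2^2"
    using that
  proof (rule SL2_induct)
    show "phi (mat 1) (mat2 1 t 0 1) \<in> A1A1_bar" "phi (mat 1) (mat2 1 0 t 1) \<in> A1A1_bar" for t :: 'k
      using gens[of "(1, 0)" t] gens[of "(-1, 0)" t] by (simp_all add: x_root_phi)
    show "phi (mat 1) (A ** B) \<in> A1A1_bar"
      if "phi (mat 1) A \<in> A1A1_bar" "phi (mat 1) B \<in> A1A1_bar" for A B :: "'k^2^2"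
      using mult[OF that] by (simp add: phi_mult)
  qed
  show "(phi_SL2 :: ('k^7^7) set) \<subseteq> A1A1_bar"
    using mult[OF long short] by (auto simp: phi_SL2_def phi_mult)
qed

section \<open>Invariant forms of the algebraic group\<close>

text \<open>
  The alternating form \<open>tr ((u v) w)\<close> on the trace zero octonions, up to sign. The five triples are
  the sets of three weights whose sum is zero, the index 4 standing for the zero weight.
\<close>
definition trilin :: "'k::comm_ring_1^7 \<Rightarrow> 'k^7 \<Rightarrow> 'k^7 \<Rightarrow> 'k" where
  "trilin u v w = (let D = (\<lambda>i j k. u$i*(v$j*w$k - v$k*w$j) - u$j*(v$i*w$k - v$k*w$i) + u$k*(v$i*w$j - v$j*w$i))
    in D 1 4 7 + D 2 4 6 - D 3 4 5 - D 1 5 6 - D 2 3 7)"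

text \<open>
  The octonion norm on trace zero elements, up to sign. The form itself is needed rather than
  its polarization, which is degenerate in characteristic 2.
\<close>
definition quad :: "'k::comm_ring_1^7 \<Rightarrow> 'k" where
  "quad u = (u$4)^2 - u$3 * u$5 + u$2 * u$6 - u$1 * u$7"

lemma x_root_quad:
  assumes "r \<in> g2_roots"
  shows "quad (x_root r t *v u) = quad u"
  using assms unfolding x_root_eq[OF assms] g2_roots_def
  by (elim insertE; simp add: chev_e_def munit_calc;
      simp add: quad_def matrix_vector_mult_def sum_7 munit_def;
      simp add: algebra_simps power2_eq_square)

lemma x_root_trilin:
  assumes "r \<in> g2_roots"
  shows "trilin (x_root r t *v u) (x_root r t *v v) (x_root r t *v w) = trilin u v w"
  using assms unfolding x_root_eq[OF assms] g2_roots_def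
  by (elim insertE; simp add: chev_e_def munit_calc;
      simp add: trilin_def matrix_vector_mult_def sum_7 munit_def;
      simp add: algebra_simps power2_eq_square)

lemma G2_bar_invariants:
  assumes "y \<in> (G2_bar :: ('k::field^7^7) set)"
  shows "quad (y *v u) = quad u" "trilin (y *v u) (y *v v) (y *v w) = trilin u v w"
proof -
  let ?I = "{y :: 'k^7^7. invertible y \<and> (\<forall>u. quad (y *v u) = quad u) \<and>
              (\<forall>u v w. trilin (y *v u) (y *v v) (y *v w) = trilin u v w)}"
  have "subgroup ?I GL"
  proof (rule group.subgroupI[OF group_GL])
    show "?I \<noteq> {}" by (auto intro!: exI[of _ "mat 1"] simp: invertible_def[of "mat 1"])
    show "inv\<^bsub>GL\<^esub> y \<in> ?I" if y: "y \<in> ?I" for y :: "'k^7^7"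
    proof -
      obtain y' where y': "y ** y' = mat 1" "y' ** y = mat 1" using y by (auto simp: invertible_def)
      have cancel: "y *v (y' *v u) = u" for u by (simp add: matrix_vector_mul_assoc y')
      have "quad (y' *v u) = quad u" for u
        using y cancel by (smt (verit) mem_Collect_eq)
      moreover have "trilin (y' *v u) (y' *v v) (y' *v w) = trilin u v w" for u v w
        using y cancel by (smt (verit) mem_Collect_eq)
      moreover have "invertible y'" using y' by (auto simp: invertible_def)
      ultimately show ?thesis using inv_GL_eq[OF y'(1)] by simp
    qed
  qed (auto simp: invertible_mult simp flip: matrix_vector_mul_assoc)
  moreover have "(\<Union>r\<in>g2_roots. range (x_root r)) \<subseteq> ?I"
    by (auto simp: x_root_invertible x_root_quad x_root_trilin)
  ultimately have "G2_bar \<subseteq> ?I"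
    unfolding G2_bar_def by (intro group.generate_subgroup_incl[OF group_GL])
  then show "quad (y *v u) = quad u" "trilin (y *v u) (y *v v) (y *v w) = trilin u v w"
    using assms by auto
qed

section \<open>The subgroup is its own normalizer\<close>

definition wdiag :: "'k \<Rightarrow> 'k \<Rightarrow> 'k::zero^7^7" where
  "wdiag \<alpha> \<beta> = vec7 (vec7 \<alpha> 0 0 0 0 0 0) (vec7 0 \<alpha> 0 0 0 0 0) (vec7 0 0 \<beta> 0 0 0 0)
     (vec7 0 0 0 \<beta> 0 0 0) (vec7 0 0 0 0 \<beta> 0 0) (vec7 0 0 0 0 0 \<alpha> 0) (vec7 0 0 0 0 0 0 \<alpha>)"

lemma wdiag_phi_commute: "wdiag \<alpha> \<beta> ** phi A B = phi A B ** wdiag \<alpha> \<beta>"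
  by (simp add: wdiag_def phi_def vec_eq_iff forall_7 matrix_matrix_mult_def sum_7 mult.commute)

lemma wdiag_mult: "wdiag \<alpha> \<beta> ** wdiag \<alpha>' \<beta>' = (wdiag (\<alpha> * \<alpha>') (\<beta> * \<beta>') :: 'k::semiring_1^7^7)"
  by (simp add: wdiag_def vec_eq_iff forall_7 matrix_matrix_mult_def sum_7)

text \<open>
  Schur's lemma for \<open>W4 \<oplus> W3\<close>. The long root elements separate the coordinates \<open>{1, 2}\<close>, \<open>{3, 4, 5}\<close> and
  \<open>{6, 7}\<close> and identify the first block with the third; the short root elements make the blocks
  scalar. In characteristic 2 the module \<open>W3\<close> is not irreducible, and short root elements with
  parameter 1 do not suffice: they generate a group of order 6 only. Comparing the linear
  and quadratic terms in the parameter requires a second value \<open>t \<noteq> 0, 1\<close>.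
\<close>
lemma phi_SL2_commutant:
  fixes M :: "'k::alg_closed_field^7^7"
  assumes comm: "\<And>h. h \<in> phi_SL2 \<Longrightarrow> M ** h = h ** M"
  obtains \<alpha> \<beta> where "M = wdiag \<alpha> \<beta>"
proof -
  \<comment> \<open>A root of \<open>t^2 + t - 1\<close> is neither 0 nor 1 in any characteristic.\<close>
  obtain t :: 'k where t: "t \<noteq> 0" "t \<noteq> 1"
  proof -
    obtain t :: 'k where "poly [:-1, 1, 1:] t = 0"
      using alg_closed_imp_poly_has_root[of "[:-1, 1, 1:] :: 'k poly"] by auto
    then show ?thesis by (intro that[of t]) (auto dest: arg_cong[where f = "\<lambda>x. x - 1"])
  qed
  note expand = phi_mat2 mat_1_eq_mat2 vec_eq_iff[of "_ :: 'k^7^7"] vec_eq_iff[of "_ :: 'k^7"]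
    forall_7 matrix_matrix_mult_def sum_7
  have "M ** phi (mat2 1 1 0 1) (mat 1) = phi (mat2 1 1 0 1) (mat 1) ** M"
    by (intro comm phi_SL2_I) (simp_all add: det_mat2)
  then have long_up: "M$6$1 = 0" "M$6$2 = 0" "M$6$3 = 0" "M$6$4 = 0" "M$6$5 = 0"
      "M$7$1 = 0" "M$7$2 = 0" "M$7$3 = 0" "M$7$4 = 0" "M$7$5 = 0"
      "M$3$1 = 0" "M$4$1 = 0" "M$5$1 = 0" "M$3$2 = 0" "M$4$2 = 0" "M$5$2 = 0"
      "M$6$6 = M$1$1" "M$6$7 = M$1$2" "M$7$6 = M$2$1" "M$7$7 = M$2$2"
    by (simp_all add: expand)
  have "M ** phi (mat2 1 0 1 1) (mat 1) = phi (mat2 1 0 1 1) (mat 1) ** M"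
    by (intro comm phi_SL2_I) (simp_all add: det_mat2)
  then have long_down: "M$1$3 = 0" "M$1$4 = 0" "M$1$5 = 0" "M$1$6 = 0" "M$1$7 = 0"
      "M$2$3 = 0" "M$2$4 = 0" "M$2$5 = 0" "M$2$6 = 0" "M$2$7 = 0"
      "M$3$6 = 0" "M$4$6 = 0" "M$5$6 = 0" "M$3$7 = 0" "M$4$7 = 0" "M$5$7 = 0"
    by (simp_all add: expand)
  have up: "M ** phi (mat 1) (mat2 1 s 0 1) = phi (mat 1) (mat2 1 s 0 1) ** M" for s
    by (intro comm phi_SL2_I) (simp_all add: det_mat2)
  have up_eqs: "s * M$2$1 = 0" "s * M$1$1 = s * M$2$2"
      "s * M$5$3 = 0" "s * M$5$4 + s^2 * M$5$3 = 0"
      "s^2 * M$4$3 + s * M$4$4 = s * M$5$5" for s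
    using up[of s] long_up long_down by (simp_all add: expand algebra_simps power2_eq_square)
  have down: "M ** phi (mat 1) (mat2 1 0 s 1) = phi (mat 1) (mat2 1 0 s 1) ** M" for s
    by (intro comm phi_SL2_I) (simp_all add: det_mat2)
  have down_eqs: "s * M$1$2 = 0"
      "s * M$3$5 = 0" "s * M$3$4 + s^2 * M$3$5 = 0" "s^2 * M$4$5 + s * M$4$4 = s * M$3$3" for s
    using down[of s] long_up long_down by (simp_all add: expand algebra_simps power2_eq_square)
  have zero: "M$2$1 = 0" "M$1$2 = 0" "M$5$3 = 0" "M$5$4 = 0" "M$3$5 = 0" "M$3$4 = 0" "M$2$2 = M$1$1"
    using up_eqs[of 1] down_eqs[of 1] by simp_all
  have linear: "x = 0" if "x + y = z" "t * x + y = z" for x y z :: 'k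
  proof -
    have "t * x = x" using that by (metis add_right_cancel)
    then have "(t - 1) * x = 0" by (simp add: algebra_simps)
    then show ?thesis using t by simp
  qed
  have "t * (t * M$4$3 + M$4$4) = t * M$5$5" "t * (t * M$4$5 + M$4$4) = t * M$3$3"
    using up_eqs(5)[of t] down_eqs(4)[of t] by (simp_all add: power2_eq_square algebra_simps)
  then have "t * M$4$3 + M$4$4 = M$5$5" "t * M$4$5 + M$4$4 = M$3$3" using t by simp_all
  moreover have "M$4$3 + M$4$4 = M$5$5" "M$4$5 + M$4$4 = M$3$3"
    using up_eqs(5)[of 1] down_eqs(4)[of 1] by simp_all
  ultimately have mid: "M$4$3 = 0" "M$4$5 = 0" by (blast intro: linear)+
  then have "M$3$3 = M$4$4" "M$4$4 = M$5$5"
    using down_eqs(4)[of 1] up_eqs(5)[of 1] by simp_all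
  then have "M = wdiag (M$1$1) (M$3$3)"
    using zero long_up long_down mid
    by (simp add: wdiag_def vec_eq_iff forall_7)
  then show ?thesis by (rule that)
qed

text \<open>
  The projection \<open>wdiag 1 0\<close> onto \<open>W4\<close> commutes with \<open>K\<close>, hence so does its conjugate by \<open>y\<close>, which
  is therefore one of the four idempotents \<open>wdiag \<alpha> \<beta>\<close>. It is neither 0 nor 1, and it is not the
  other projection, because the traces 4 and 3 differ in every characteristic.
\<close>
lemma normalizer_block_diagonal:
  fixes y y' :: "'k::alg_closed_field^7^7"
  assumes inv: "y ** y' = mat 1" "y' ** y = mat 1"
    and normal: "\<And>h. h \<in> phi_SL2 \<Longrightarrow> y' ** h ** y \<in> phi_SL2"
  shows "y ** wdiag 1 0 = wdiag 1 0 ** y"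
proof -
  define M where "M = y ** wdiag 1 0 ** y'"
  have "M ** h = h ** M" if "h \<in> phi_SL2" for h
  proof -
    obtain A B where AB: "y' ** h ** y = phi A B" using normal[OF \<open>h \<in> phi_SL2\<close>] by (auto simp: phi_SL2_def)
    have "M ** h = y ** (wdiag 1 0 ** (y' ** h ** y)) ** y'"
      by (simp add: M_def matrix_mul_assoc[symmetric] inv)
    also have "\<dots> = y ** (y' ** h ** y ** wdiag 1 0) ** y'"
      by (simp only: AB wdiag_phi_commute)
    also have "\<dots> = h ** M"
      by (simp add: M_def matrix_mul_assoc inv)
    finally show ?thesis .
  qed
  then obtain \<alpha> \<beta> where M: "M = wdiag \<alpha> \<beta>" by (rule phi_SL2_commutant)
  have My: "M ** y = y ** wdiag 1 0" by (simp add: M_def matrix_mul_assoc[symmetric] inv)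
  have "M ** M = y ** wdiag 1 0 ** (y' ** y) ** wdiag 1 0 ** y'"
    by (simp add: M_def matrix_mul_assoc)
  also have "\<dots> = M"
    by (simp add: M_def inv wdiag_mult flip: matrix_mul_assoc)
  finally have "\<alpha> * \<alpha> = \<alpha>" "\<beta> * \<beta> = \<beta>"
    unfolding M wdiag_mult by (auto simp: wdiag_def dest!: arg_cong[where f = "\<lambda>M. (M$1$1, M$3$3)"])
  then have idem: "\<alpha> = 0 \<or> \<alpha> = 1" "\<beta> = 0 \<or> \<beta> = 1" by auto
  have "trace M = trace (wdiag 1 0 :: 'k^7^7)"
    unfolding M_def by (metis trace_mul_sym inv(2) matrix_mul_assoc matrix_mul_lid)
  then have tr: "4 * \<alpha> + 3 * \<beta> = 4"
    by (simp add: M trace_def sum_7 wdiag_def)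
  have pi: "wdiag 1 0 = y' ** M ** y"
    by (metis My inv(2) matrix_mul_assoc matrix_mul_lid)
  have "\<not> (\<alpha> = 0 \<and> \<beta> = 0)"
  proof
    assume "\<alpha> = 0 \<and> \<beta> = 0"
    then have "M = 0" by (simp add: M wdiag_def vec_eq_iff forall_7)
    then have "wdiag 1 0 = (0 :: 'k^7^7)" using pi by (simp add: matrix_mult_zero)
    then show False by (auto simp: wdiag_def dest!: arg_cong[where f = "\<lambda>M. M$1$1"])
  qed
  moreover have "\<not> (\<alpha> = 1 \<and> \<beta> = 1)"
  proof
    assume "\<alpha> = 1 \<and> \<beta> = 1"
    then have "M = mat 1" by (simp add: M wdiag_def vec_eq_iff forall_7) (simp add: mat_def)
    then have "wdiag 1 0 = (mat 1 :: 'k^7^7)" using pi inv by simp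
    then show False by (auto simp: wdiag_def mat_def dest!: arg_cong[where f = "\<lambda>M. M$3$3"])
  qed
  moreover have "\<not> (\<alpha> = 0 \<and> \<beta> = 1)"
  proof
    assume "\<alpha> = 0 \<and> \<beta> = 1"
    with tr have "(4 :: 'k) - 3 = 0" by simp
    then show False by simp
  qed
  ultimately have "M = wdiag 1 0" using idem M by auto
  then show ?thesis using My by simp
qed

lemma cross_zero:
  fixes a b c d :: "'k::comm_ring_1"
  assumes det: "a * d - b * c = 1" and eqs: "a * y = b * x" "c * y = d * x"
  shows "x = 0" "y = 0"
proof -
  have "x = (a * d - b * c) * x" by (simp add: det)
  also have "\<dots> = a * (d * x) - c * (b * x)" by (simp add: algebra_simps)
  also have "\<dots> = 0" by (simp add: mult.left_commute flip: eqs)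
  finally show "x = 0" .
  have "y = (a * d - b * c) * y" by (simp add: det)
  also have "\<dots> = d * (a * y) - b * (c * y)" by (simp add: algebra_simps)
  also have "\<dots> = 0" by (simp add: eqs \<open>x = 0\<close>)
  finally show "y = 0" .
qed

lemma cramer:
  fixes a b c d :: "'k::comm_ring_1"
  assumes det: "a * d - b * c = 1" and eqs: "d * x - c * y = r" "a * y - b * x = s"
  shows "x = r * a + s * c" "y = r * b + s * d"
proof -
  have "x = (a * d - b * c) * x" "y = (a * d - b * c) * y" by (simp_all add: det)
  then show "x = r * a + s * c" "y = r * b + s * d" by (simp_all add: algebra_simps flip: eqs)
qed

text \<open>
  Contracting the trilinear form with the three basis vectors of \<open>W3\<close> gives three alternating forms
  on \<open>W4\<close>, in coordinates \<open>x1 \<and> x6\<close>, \<open>x2 \<and> x7\<close> and \<open>x1 \<and> x7 + x2 \<and> x6\<close> up to sign. The radicals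
  of the first two are the planes \<open>{2, 7}\<close> and \<open>{1, 6}\<close>, so these are preserved; the third form is a
  perfect pairing of them, so the action on one plane determines the action on the other.
\<close>
lemma centralizer_phi:
  fixes y :: "'k::field^7^7"
  assumes quad: "\<And>u. quad (y *v u) = quad u"
    and trilin: "\<And>u v w. trilin (y *v u) (y *v v) (y *v w) = trilin u v w"
    and block: "y ** wdiag 1 0 = wdiag 1 0 ** y"
    and fix3: "y *v vec7 0 0 1 0 0 0 0 = vec7 0 0 1 0 0 0 0"
    and fix5: "y *v vec7 0 0 0 0 1 0 0 = vec7 0 0 0 0 1 0 0"
  shows "y \<in> phi_SL2"
proof -
  note mv = matrix_vector_mult_def sum_7
  have off: "y$1$3 = 0" "y$1$4 = 0" "y$1$5 = 0" "y$2$3 = 0" "y$2$4 = 0" "y$2$5 = 0"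
      "y$6$3 = 0" "y$6$4 = 0" "y$6$5 = 0" "y$7$3 = 0" "y$7$4 = 0" "y$7$5 = 0"
      "y$3$1 = 0" "y$3$2 = 0" "y$3$6 = 0" "y$3$7 = 0" "y$4$1 = 0" "y$4$2 = 0" "y$4$6 = 0" "y$4$7 = 0"
      "y$5$1 = 0" "y$5$2 = 0" "y$5$6 = 0" "y$5$7 = 0"
    using block by (simp_all add: wdiag_def vec_eq_iff forall_7 matrix_matrix_mult_def sum_7)
  have col3: "y$3$3 = 1" "y$4$3 = 0" "y$5$3 = 0"
    and col5: "y$3$5 = 0" "y$4$5 = 0" "y$5$5 = 1"
    using fix3 fix5 by (simp_all add: vec_eq_iff forall_7 mv)
  have "y$5$4 = 0" "y$3$4 = 0"
    using quad[of "vec7 0 0 0 1 0 0 0"] quad[of "vec7 0 0 1 1 0 0 0"] quad[of "vec7 0 0 0 1 1 0 0"]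
    by (simp_all add: quad_def mv off col3 col5 algebra_simps)
  moreover have "y$4$4 = 1"
    using trilin[of "vec7 0 0 1 0 0 0 0" "vec7 0 0 0 1 0 0 0" "vec7 0 0 0 0 1 0 0"]
    by (simp add: trilin_def mv off col3 col5)
  ultimately have col4: "y$3$4 = 0" "y$4$4 = 1" "y$5$4 = 0" by auto
  note W3 = off col3 col4 col5
  let ?e1 = "vec7 1 0 0 0 0 0 0 :: 'k^7" and ?e2 = "vec7 0 1 0 0 0 0 0 :: 'k^7"
  let ?e6 = "vec7 0 0 0 0 0 1 0 :: 'k^7" and ?e7 = "vec7 0 0 0 0 0 0 1 :: 'k^7"
  note form5 = trilin[of "vec7 0 0 0 0 1 0 0"] and form3 = trilin[of "vec7 0 0 1 0 0 0 0"]
    and form4 = trilin[of "vec7 0 0 0 1 0 0 0"]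
  have "y$1$1 * y$6$6 - y$6$1 * y$1$6 = 1"
    and "y$1$1 * y$6$2 = y$6$1 * y$1$2" "y$1$6 * y$6$2 = y$6$6 * y$1$2"
    and "y$1$1 * y$6$7 = y$6$1 * y$1$7" "y$1$6 * y$6$7 = y$6$6 * y$1$7"
    using form5[of ?e1 ?e6] form5[of ?e1 ?e2] form5[of ?e6 ?e2] form5[of ?e1 ?e7] form5[of ?e6 ?e7]
    by (simp_all add: trilin_def mv W3 algebra_simps)
  note det16 = this(1) and zero16 = cross_zero[OF this(1,2,3)] cross_zero[OF this(1,4,5)]
  have "y$2$2 * y$7$7 - y$7$2 * y$2$7 = 1"
    and "y$2$2 * y$7$1 = y$7$2 * y$2$1" "y$2$7 * y$7$1 = y$7$7 * y$2$1"
    and "y$2$2 * y$7$6 = y$7$2 * y$2$6" "y$2$7 * y$7$6 = y$7$7 * y$2$6"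
    using form3[of ?e2 ?e7] form3[of ?e2 ?e1] form3[of ?e7 ?e1] form3[of ?e2 ?e6] form3[of ?e7 ?e6]
    by (simp_all add: trilin_def mv W3 algebra_simps)
  note zero27 = cross_zero[OF this(1,2,3)] cross_zero[OF this(1,4,5)]
  have "y$6$6 * y$2$2 - y$1$6 * y$7$2 = 1" "y$1$1 * y$7$2 - y$6$1 * y$2$2 = 0"
      "y$6$6 * y$2$7 - y$1$6 * y$7$7 = 0" "y$1$1 * y$7$7 - y$6$1 * y$2$7 = 1"
    using form4[of ?e2 ?e6] form4[of ?e1 ?e2] form4[of ?e6 ?e7] form4[of ?e1 ?e7]
    by (simp_all add: trilin_def mv W3 zero16 zero27 algebra_simps)
  note equal = cramer[OF det16 this(1,2)] cramer[OF det16 this(3,4)]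
  have "y = phi (mat2 (y$1$1) (- y$1$6) (- y$6$1) (y$6$6)) (mat 1)"
    using W3 zero16 zero27 equal by (simp add: mat_1_eq_mat2 phi_mat2 vec_eq_iff forall_7)
  also have "\<dots> \<in> phi_SL2"
    using det16 by (intro phi_SL2_I) (simp_all add: det_mat2 algebra_simps)
  finally show ?thesis .
qed

lemma square_root_exists: "\<exists>s :: 'k::alg_closed_field. s^2 = x"
  using nth_root_exists[of 2 x] by auto

text \<open>
  The singular vectors of \<open>W3\<close> are \<open>(s^2, s t, t^2)\<close>, and columns 3 and 5 of \<open>phi (mat 1) B\<close> have this
  form with \<open>(s, t)\<close> the columns of \<open>B\<close>. The value of the form on the sum of the two columns
  says that the determinant of \<open>B\<close> is \<open>\<plusminus>1\<close>; the sign of the second column of \<open>B\<close> is free.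
\<close>
lemma action_on_W3:
  fixes y :: "'k::alg_closed_field^7^7"
  assumes quad: "\<And>u. quad (y *v u) = quad u"
    and block: "y ** wdiag 1 0 = wdiag 1 0 ** y"
  obtains B where "det B = 1"
    "y *v vec7 0 0 1 0 0 0 0 = phi (mat 1) B *v vec7 0 0 1 0 0 0 0"
    "y *v vec7 0 0 0 0 1 0 0 = phi (mat 1) B *v vec7 0 0 0 0 1 0 0"
proof -
  note mv = matrix_vector_mult_def sum_7
  have off: "y$1$3 = 0" "y$1$5 = 0" "y$2$3 = 0" "y$2$5 = 0"
      "y$6$3 = 0" "y$6$5 = 0" "y$7$3 = 0" "y$7$5 = 0"
    using block by (simp_all add: wdiag_def vec_eq_iff forall_7 matrix_matrix_mult_def sum_7)
  have param: "\<exists>s t. p = s^2 \<and> q = s * t \<and> r = t^2" if "q^2 = p * r" for p q r :: 'k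
  proof -
    obtain s t where st: "s^2 = p" "t^2 = r" using square_root_exists by metis
    then have "q^2 = (s * t)^2" using that by (simp add: power_mult_distrib)
    then have "q = s * t \<or> q = s * (- t)" by (simp add: power2_eq_iff)
    then show ?thesis using st by (metis power2_minus)
  qed
  have "(y$4$3)^2 = y$3$3 * y$5$3" "(y$4$5)^2 = y$3$5 * y$5$5"
    using quad[of "vec7 0 0 1 0 0 0 0"] quad[of "vec7 0 0 0 0 1 0 0"]
    by (simp_all add: quad_def mv off)
  then obtain e g f h where eg: "y$3$3 = e^2" "y$4$3 = e * g" "y$5$3 = g^2"
    and fh: "y$3$5 = f^2" "y$4$5 = f * h" "y$5$5 = h^2"
    using param by metis
  have "(e * h - f * g)^2 = 1"
    using quad[of "vec7 0 0 1 0 1 0 0"]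
    by (simp add: quad_def mv off eg fh) algebra
  then have "e * h - f * g = 1 \<or> e * (- h) - (- f) * g = 1"
    by (auto simp: power2_eq_1_iff algebra_simps)
  then obtain f' h' where det: "e * h' - f' * g = 1"
    and fh': "y$3$5 = f'^2" "y$4$5 = f' * h'" "y$5$5 = h'^2"
    using fh by (metis minus_mult_minus power2_minus)
  show ?thesis
  proof (rule that[of "mat2 e f' g h'"])
    show "det (mat2 e f' g h') = 1" using det by (simp add: det_mat2)
    show "y *v vec7 0 0 1 0 0 0 0 = phi (mat 1) (mat2 e f' g h') *v vec7 0 0 1 0 0 0 0"
      "y *v vec7 0 0 0 0 1 0 0 = phi (mat 1) (mat2 e f' g h') *v vec7 0 0 0 0 1 0 0"
      by (simp_all add: mat_1_eq_mat2 phi_mat2 vec_eq_iff forall_7 mv off eg fh')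
  qed
qed

lemma phi_SL2_subset_G2_bar: "(phi_SL2 :: ('k::field^7^7) set) \<subseteq> G2_bar"
  unfolding A1A1_bar_eq[symmetric] A1A1_bar_def G2_bar_def
  by (intro group.mono_generate[OF group_GL]) (auto simp: g2_roots_def)

text \<open>
  Dividing \<open>y\<close> by the element \<open>phi (mat 1) B\<close> that agrees with it on two basis vectors of \<open>W3\<close> leaves
  an element that fixes both of these.
\<close>
lemma phi_SL2_self_normalizing:
  fixes y y' :: "'k::alg_closed_field^7^7"
  assumes y: "y \<in> G2_bar" and inv: "y ** y' = mat 1" "y' ** y = mat 1"
    and normal: "\<And>h. h \<in> phi_SL2 \<Longrightarrow> y' ** h ** y \<in> phi_SL2"
  shows "y \<in> phi_SL2"
proof -
  interpret G2_bar: subgroup "G2_bar :: ('k^7^7) set" GL by (rule subgroup_G2_bar)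
  interpret phi_SL2: subgroup "phi_SL2 :: ('k^7^7) set" GL by (rule subgroup_phi_SL2)
  have block: "y ** wdiag 1 0 = wdiag 1 0 ** y"
    by (rule normalizer_block_diagonal[OF inv normal])
  obtain B where B: "det B = 1"
      "y *v vec7 0 0 1 0 0 0 0 = phi (mat 1) B *v vec7 0 0 1 0 0 0 0"
      "y *v vec7 0 0 0 0 1 0 0 = phi (mat 1) B *v vec7 0 0 0 0 1 0 0"
    using action_on_W3[OF G2_bar_invariants(1)[OF y] block] by metis
  obtain B' where B': "det B' = 1" "B ** B' = mat 1" "B' ** B = mat 1"
    by (rule mat2_inverse[OF B(1)])
  define z where "z = phi (mat 1) B' ** y"
  have "phi (mat 1) B' \<in> phi_SL2" using B' by (intro phi_SL2_I) auto
  then have z: "z \<in> G2_bar"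
    unfolding z_def using G2_bar.m_closed[of "phi (mat 1) B'" y] y phi_SL2_subset_G2_bar by auto
  have "z \<in> phi_SL2"
  proof (rule centralizer_phi)
    show "quad (z *v u) = quad u" "trilin (z *v u) (z *v v) (z *v w) = trilin u v w" for u v w
      using G2_bar_invariants[OF z] by auto
    show "z ** wdiag 1 0 = wdiag 1 0 ** z"
    proof -
      have "z ** wdiag 1 0 = phi (mat 1) B' ** wdiag 1 0 ** y"
        by (simp add: z_def block flip: matrix_mul_assoc)
      then show ?thesis by (simp add: z_def matrix_mul_assoc wdiag_phi_commute)
    qed
    have "phi (mat 1) B' *v (phi (mat 1) B *v u) = u" for u
      by (simp add: matrix_vector_mul_assoc phi_mult B' phi_one)
    then show "z *v vec7 0 0 1 0 0 0 0 = vec7 0 0 1 0 0 0 0" "z *v vec7 0 0 0 0 1 0 0 = vec7 0 0 0 0 1 0 0"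
      unfolding z_def by (simp_all add: B flip: matrix_vector_mul_assoc)
  qed
  then have "phi (mat 1) B ** z \<in> phi_SL2"
    using phi_SL2.m_closed[of "phi (mat 1) B" z] B(1) by (simp add: phi_SL2_I)
  moreover have "phi (mat 1) B ** z = y"
    by (simp add: z_def matrix_mul_assoc phi_mult B' phi_one)
  ultimately show ?thesis by simp
qed

section \<open>Lang's theorem for the subgroup\<close>

lemma (in group) conjugate_set_mult:
  assumes K: "subgroup K G" and m: "m \<in> K" and g: "g \<in> carrier G"
  shows "conjugate_set G K (m \<otimes> g) = conjugate_set G K g"
proof -
  interpret K: subgroup K G by (rule K)
  have sub: "conjugate_set G K (m \<otimes> g) \<subseteq> conjugate_set G K g"
    if "m \<in> K" "g \<in> carrier G" for m g
  proof -
    have "inv (m \<otimes> g) \<otimes> h \<otimes> (m \<otimes> g) = inv g \<otimes> (inv m \<otimes> h \<otimes> m) \<otimes> g" if "h \<in> K" for h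
      using that \<open>m \<in> K\<close> \<open>g \<in> carrier G\<close> by (simp add: inv_mult_group m_assoc)
    then show ?thesis using \<open>m \<in> K\<close> unfolding conjugate_set_def by auto
  qed
  have "inv m \<otimes> (m \<otimes> g) = g" using m g by (simp flip: m_assoc)
  then show ?thesis using sub[OF m g] sub[of "inv m" "m \<otimes> g"] m g by auto
qed

definition frob2 :: "nat \<Rightarrow> 'k::field^2^2 \<Rightarrow> 'k^2^2" where
  "frob2 q A = (\<chi> i j. (A$i$j)^q)"

lemma frob2_mat2: "frob2 q (mat2 a b c d) = mat2 (a^q) (b^q) (c^q) (d^q)"
  by (simp add: frob2_def vec_eq_iff forall_2)

lemma trinomial_root:
  fixes r s :: "'k::alg_closed_field"
  assumes "l > 0" "m > l"
  obtains x where "x ^ m + s * x ^ l + r = 0"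
proof -
  let ?p = "monom 1 m + monom s l + [:r:]"
  have "coeff ?p m = 1" using assms by (simp add: coeff_pCons split: nat.split)
  then have "degree ?p \<ge> m" by (metis le_degree zero_neq_one)
  then have "degree ?p > 0" using assms by simp
  then obtain x where "poly ?p x = 0" using alg_closed_imp_poly_has_root by blast
  then show ?thesis by (intro that[of x]) (simp add: poly_monom)
qed

context
  fixes q n :: nat
  assumes prime: "prime CHAR('k::alg_closed_field)" and q: "q = CHAR('k) ^ n" and n: "n \<ge> 1"
begin

lemma q_gt_1: "q > 1"
  using prime_gt_1_nat[OF prime] n unfolding q by (intro one_less_power) auto

lemma power_q_add: "((x :: 'k) + y) ^ q = x ^ q + y ^ q"
  by (rule freshmans_dream'[OF prime q])

lemma power_q_minus: "(- x :: 'k) ^ q = - (x ^ q)"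
  using power_q_add[of x "- x"] q_gt_1 by (simp add: power_0_left add_eq_0_iff)

lemma power_q_diff: "((x :: 'k) - y) ^ q = x ^ q - y ^ q"
  using power_q_add[of x "- y"] by (simp add: power_q_minus)

lemma power_q_inj: "(x :: 'k) ^ q = y ^ q \<Longrightarrow> x = y"
  using power_q_diff[of x y] by simp

lemma frob2_mult: "frob2 q (A ** B) = frob2 q A ** (frob2 q B :: 'k^2^2)"
  by (simp add: frob2_def vec_eq_iff matrix_matrix_mult_def sum_2 power_q_add power_mult_distrib)

lemma det_frob2: "det (frob2 q A :: 'k^2^2) = det A ^ q"
  by (simp add: frob2_def det_2 power_q_diff power_mult_distrib)

lemma frob_phi: "frob q (phi A B :: 'k^7^7) = phi (frob2 q A) (frob2 q B)"
proof -
  have "(2 :: 'k) ^ q = 2" using of_int_power_CHAR[OF prime q, of 2] by simp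
  then show ?thesis
    using q_gt_1
    by (simp add: frob_def phi_def frob2_def vec_eq_iff[of "_ :: 'k^7^7"] vec_eq_iff[of "_ :: 'k^7"] forall_7
        power_q_add power_q_minus power_mult_distrib power_0_left flip: power_mult)
      (simp add: mult.commute)
qed

lemma frob_phi_SL2: "frob q ` phi_SL2 = (phi_SL2 :: ('k^7^7) set)"
proof
  show "frob q ` phi_SL2 \<subseteq> (phi_SL2 :: ('k^7^7) set)"
  proof
    fix h :: "'k^7^7" assume "h \<in> frob q ` phi_SL2"
    then obtain A B where "h = frob q (phi A B)" "det A = 1" "det B = 1" by (auto simp: phi_SL2_def)
    then show "h \<in> phi_SL2" by (simp add: frob_phi det_frob2 phi_SL2_I)
  qed
  have root: "\<exists>A0. frob2 q A0 = A \<and> det A0 = 1" if "det A = 1" for A :: "'k^2^2"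
  proof -
    obtain r where r: "r x ^ q = x" for x :: 'k
      using nth_root_exists[of q] q_gt_1 by (metis less_trans zero_less_one)
    have "frob2 q (\<chi> i j. r (A$i$j)) = A" by (simp add: frob2_def vec_eq_iff r)
    then show ?thesis
      using that det_frob2 power_q_inj by (metis power_one)
  qed
  show "(phi_SL2 :: ('k^7^7) set) \<subseteq> frob q ` phi_SL2"
  proof
    fix h :: "'k^7^7" assume "h \<in> phi_SL2"
    then obtain A B where "h = phi A B" "det A = 1" "det B = 1" by (auto simp: phi_SL2_def)
    with root[of A] root[of B] show "h \<in> frob q ` phi_SL2"
      by (metis frob_phi image_eqI phi_SL2_I)
  qed
qed

text \<open>
  A nonzero row vector fixed by the semilinear map \<open>r \<mapsto> \<sigma>(r) A\<close>. For \<open>c \<noteq> 0\<close>, the first equation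
  and \<open>det A = 1\<close> give \<open>c y = d x - x^q\<close>; substituting this back leaves an additive
  polynomial of degree \<open>q^2\<close> in \<open>x\<close>, whose quotient by \<open>x\<close> has the nonzero constant term
  \<open>c^(q-1)\<close> and therefore a nonzero root.
\<close>
lemma semilinear_fixed_row:
  fixes a b c d :: 'k
  assumes det: "a * d - b * c = 1"
  obtains x y where "x \<noteq> 0 \<or> y \<noteq> 0" "x = a * x ^ q + c * y ^ q" "y = b * x ^ q + d * y ^ q"
proof (cases "c = 0")
  case True
  then have "d \<noteq> 0" using det by auto
  obtain y where "y ^ (q - 1) = 1 / d" using nth_root_exists[of "q - 1" "1 / d"] q_gt_1 by auto
  then have y: "d * y ^ (q - 1) = 1" using \<open>d \<noteq> 0\<close> by simp
  have "d * y ^ q = y * (d * y ^ (q - 1))"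
    using q_gt_1 by (simp add: power_eq_if[of y q])
  then show ?thesis
    using y True q_gt_1 by (intro that[of 0 y]) (auto simp: power_0_left)
next
  case False
  let ?s = "- (d ^ q + a * c ^ (q - 1))"
  have "q - 1 > 0" "q ^ 2 - 1 > q - 1" using q_gt_1 by (auto simp: power2_eq_square intro!: diff_less_mono)
  then obtain x where x: "x ^ (q^2 - 1) + ?s * x ^ (q - 1) + c ^ (q - 1) = 0"
    by (rule trinomial_root)
  moreover have "q ^ 2 > 1" using q_gt_1 by (intro one_less_power) auto
  ultimately have "x \<noteq> 0" using False q_gt_1 by (auto simp: power_0_left)
  have "x * (x ^ (q^2 - 1) + ?s * x ^ (q - 1) + c ^ (q - 1)) = x ^ (q^2) + ?s * x ^ q + c ^ (q - 1) * x"
    using q_gt_1 by (simp add: power_eq_if[of x "q^2"] power_eq_if[of x q] algebra_simps)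
  then have "x ^ (q^2) + ?s * x ^ q + c ^ (q - 1) * x = 0" by (simp only: x mult_zero_right)
  then have root: "d ^ q * x ^ q - x ^ (q^2) = c ^ (q - 1) * (x - a * x ^ q)"
    by (simp add: algebra_simps)
  define y where "y = (d * x - x ^ q) / c"
  have "y ^ q = (d ^ q * x ^ q - x ^ (q^2)) / c ^ q"
    by (simp add: y_def power_divide power_q_diff power_mult_distrib power2_eq_square flip: power_mult)
  also have "\<dots> = (x - a * x ^ q) / c"
    using False q_gt_1 by (simp add: root power_eq_if[of c q])
  finally have yq: "c * y ^ q = x - a * x ^ q" using False by simp
  have "c * (b * x ^ q + d * y ^ q) = (b * c) * x ^ q + d * (c * y ^ q)" by (simp add: algebra_simps)
  also have "\<dots> = d * x - (a * d - b * c) * x ^ q" by (simp add: yq algebra_simps)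
  also have "\<dots> = c * y" using False by (simp add: det y_def)
  finally have "y = b * x ^ q + d * y ^ q" using False by simp
  then show ?thesis using \<open>x \<noteq> 0\<close> yq by (intro that[of x y]) auto
qed

text \<open>
  A fixed row \<open>(x, y)\<close>, completed to a matrix of determinant 1 by a row \<open>(u, v)\<close>, solves the
  equation up to a multiple \<open>l (x, y)\<close> in the second row. Adding \<open>w (x, y)\<close> to the second row
  changes this error by \<open>w^q - w\<close>, so \<open>w\<close> is chosen as a root of an Artin-Schreier equation.
\<close>
lemma lang_SL2:
  fixes A :: "'k^2^2"
  assumes "det A = 1"
  obtains C where "det C = 1" "C = frob2 q C ** A"
proof -
  obtain a b c d where A: "A = mat2 a b c d" by (rule mat2_cases)
  have det: "a * d - b * c = 1" using assms by (simp add: A det_mat2)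
  obtain x y where xy: "x \<noteq> 0 \<or> y \<noteq> 0" "x = a * x ^ q + c * y ^ q" "y = b * x ^ q + d * y ^ q"
    by (rule semilinear_fixed_row[OF det])
  have "\<exists>u v. x * v - y * u = 1"
    using xy(1) by (metis diff_zero mult_zero_right nonzero_eq_divide_eq mult.commute diff_0
        minus_mult_right minus_minus)
  then obtain u v where uv: "x * v - y * u = 1" by blast
  define r where "r = a * u ^ q + c * v ^ q"
  define s where "s = b * u ^ q + d * v ^ q"
  have FA: "frob2 q (mat2 x y u v) ** A = mat2 x y r s"
    using xy by (simp add: A frob2_mat2 mat2_mult r_def s_def mult.commute)
  have "det (frob2 q (mat2 x y u v) ** A) = 1"
    by (simp add: det_mul det_frob2 det_mat2 uv assms)
  then have rs: "x * s - y * r = 1" by (simp add: FA det_mat2)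
  obtain w where w: "w ^ q + (- 1) * w ^ 1 + (r * v - u * s) = 0"
    using trinomial_root[of 1 q] q_gt_1 by (metis zero_less_one)
  define l where "l = r * v - u * s"
  have w: "w = w ^ q + l" using w by (simp add: l_def algebra_simps add_eq_0_iff)
  have "r - u = r * (x * v - y * u) - u * (x * s - y * r)" by (simp add: uv rs)
  then have "r = u + x * l" by (simp add: l_def algebra_simps)
  moreover have "s - v = s * (x * v - y * u) - v * (x * s - y * r)" by (simp add: uv rs)
  then have "s = v + y * l" by (simp add: l_def algebra_simps)
  ultimately have C: "w * x + u = w ^ q * x + r" "w * y + v = w ^ q * y + s"
    using arg_cong[OF w, of "\<lambda>z. z * x"] arg_cong[OF w, of "\<lambda>z. z * y"]
    by (simp_all add: algebra_simps)
  let ?C = "mat2 1 0 w 1 ** mat2 x y u v"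
  show ?thesis
  proof (rule that[of ?C])
    show "det ?C = 1" by (simp add: det_mul det_mat2 uv)
    have "frob2 q ?C ** A = frob2 q (mat2 1 0 w 1) ** mat2 x y r s"
      by (simp add: frob2_mult FA flip: matrix_mul_assoc)
    also have "\<dots> = ?C"
      using q_gt_1 C by (simp add: frob2_mat2 mat2_mult power_0_left)
    finally show "?C = frob2 q ?C ** A" by simp
  qed
qed

lemma frob_G2_bar: "g \<in> G2_bar \<Longrightarrow> frob q (g :: 'k^7^7) \<in> G2_bar"
  unfolding G2_bar_def
proof (induction rule: generate.induct)
  case one
  then show ?case using frob_one[of q] q_gt_1 by (metis GL_simps(3) generate.one gr0I not_one_less_zero)
next
  case (incl h)
  then obtain r t where "h = x_root r t" "r \<in> g2_roots" by auto
  then show ?case by (auto simp: frob_x_root[OF prime q] intro!: generate.incl)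
next
  case (inv h)
  then obtain r t where h: "h = x_root r t" and r: "r \<in> g2_roots" by auto
  have "inv\<^bsub>GL\<^esub> h = x_root r (- t)"
    by (intro inv_GL_eq) (simp add: h r x_root_add x_root_0)
  then show ?case using r by (auto simp: frob_x_root[OF prime q] intro!: generate.incl)
next
  case (eng h1 h2)
  then show ?case using generate.eng[OF eng.IH] by (simp add: frob_mult[OF prime q])
qed

text \<open>
  If \<open>K^g\<close> is \<open>\<sigma>\<close>-stable, then \<open>y = \<sigma>(g) g^{-1}\<close> normalizes \<open>K\<close>, hence lies in it. Lang's theorem
  gives \<open>m \<in> K\<close> with \<open>\<sigma>(m) y = m\<close>, so that \<open>m g\<close> is fixed by \<open>\<sigma>\<close>, while \<open>K^{m g} = K^g\<close>.
\<close>
lemma max_rank_A1A1_conjugate: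
  assumes "max_rank_A1A1 q (H :: ('k^7^7) set)"
  obtains x where "x \<in> G2_bar" "frob q x = x" "H = {h \<in> conjugate_set GL phi_SL2 x. frob q h = h}"
proof -
  interpret G2_bar: subgroup "G2_bar :: ('k^7^7) set" GL by (rule subgroup_G2_bar)
  interpret phi_SL2: subgroup "phi_SL2 :: ('k^7^7) set" GL by (rule subgroup_phi_SL2)
  let ?\<sigma> = "frob q :: 'k^7^7 \<Rightarrow> 'k^7^7"
  have \<sigma>_mult: "?\<sigma> (A ** B) = ?\<sigma> A ** ?\<sigma> B" for A B by (rule frob_mult[OF prime q])
  have \<sigma>_one: "?\<sigma> (mat 1) = mat 1" using frob_one[of q] q_gt_1 by simp
  obtain g where g: "g \<in> G2_bar"
    and stable: "?\<sigma> ` conjugate_set GL phi_SL2 g = conjugate_set GL phi_SL2 g"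
    and H: "H = {h \<in> conjugate_set GL phi_SL2 g. ?\<sigma> h = h}"
    using assms unfolding max_rank_A1A1_def A1A1_bar_eq by auto
  define g' where "g' = inv\<^bsub>GL\<^esub> g"
  have g': "g' \<in> G2_bar" unfolding g'_def by (rule G2_bar.m_inv_closed[OF g])
  have gg': "g ** g' = mat 1" "g' ** g = mat 1"
    using group.r_inv[OF group_GL, of g] group.l_inv[OF group_GL, of g] G2_bar.subset g
    by (auto simp: g'_def)
  have \<sigma>gg': "?\<sigma> g ** ?\<sigma> g' = mat 1" "?\<sigma> g' ** ?\<sigma> g = mat 1"
    by (simp_all add: gg' \<sigma>_one flip: \<sigma>_mult)
  have conj: "conjugate_set GL phi_SL2 g = (\<lambda>h. g' ** h ** g) ` phi_SL2"
    by (simp add: conjugate_set_def g'_def)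
  define y where "y = ?\<sigma> g ** g'"
  define y' where "y' = g ** ?\<sigma> g'"
  have "y ** y' = ?\<sigma> g ** (g' ** g) ** ?\<sigma> g'" "y' ** y = g ** (?\<sigma> g' ** ?\<sigma> g) ** g'"
    by (simp_all add: y_def y'_def matrix_mul_assoc)
  then have yy': "y ** y' = mat 1" "y' ** y = mat 1" by (simp_all add: gg' \<sigma>gg')
  have "y \<in> phi_SL2"
  proof (rule phi_SL2_self_normalizing[OF _ yy'])
    show "y \<in> G2_bar"
      unfolding y_def using G2_bar.m_closed[OF frob_G2_bar[OF g] g'] by simp
    fix h :: "'k^7^7" assume "h \<in> phi_SL2"
    then obtain h0 where h0: "h0 \<in> phi_SL2" "h = ?\<sigma> h0" using frob_phi_SL2 by blast
    have "?\<sigma> (g' ** h0 ** g) \<in> conjugate_set GL phi_SL2 g"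
      using stable h0 unfolding conj by blast
    then obtain k where k: "k \<in> phi_SL2" "?\<sigma> g' ** h ** ?\<sigma> g = g' ** k ** g"
      unfolding conj by (auto simp: \<sigma>_mult h0)
    have "y' ** h ** y = g ** (?\<sigma> g' ** h ** ?\<sigma> g) ** g'"
      by (simp add: y_def y'_def matrix_mul_assoc)
    also have "\<dots> = (g ** g') ** k ** (g ** g')" unfolding k(2) by (simp only: matrix_mul_assoc)
    finally show "y' ** h ** y \<in> phi_SL2" using k by (simp add: gg')
  qed
  then obtain A B where y: "y = phi A B" and det: "det A = 1" "det B = 1" by (auto simp: phi_SL2_def)
  obtain C where C: "det C = 1" "C = frob2 q C ** A" by (rule lang_SL2[OF det(1)])
  obtain D where D: "det D = 1" "D = frob2 q D ** B" by (rule lang_SL2[OF det(2)])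
  define m where "m = phi C D"
  have m: "m \<in> phi_SL2" "?\<sigma> m ** y = m"
    using C D by (simp_all add: m_def y frob_phi phi_mult phi_SL2_I)
  show ?thesis
  proof (rule that[of "m ** g"])
    show "m ** g \<in> G2_bar"
      using G2_bar.m_closed[OF _ g] phi_SL2_subset_G2_bar m(1) by auto
    have "?\<sigma> (m ** g) = ?\<sigma> m ** (?\<sigma> g ** g') ** g"
      by (simp add: \<sigma>_mult gg' flip: matrix_mul_assoc)
    then show "?\<sigma> (m ** g) = m ** g" using m(2) by (simp add: y_def)
    show "H = {h \<in> conjugate_set GL phi_SL2 (m ** g). ?\<sigma> h = h}"
      using group.conjugate_set_mult[OF group_GL subgroup_phi_SL2 m(1), of g] G2_bar.subset g
      by (auto simp: H)
  qed
qed

end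

section \<open>A conjugate that meets the subgroup trivially\<close>

lemma phi_SL2_block:
  assumes "h \<in> (phi_SL2 :: ('k::field^7^7) set)"
  shows "i \<in> {1, 2, 6, 7} \<Longrightarrow> j \<in> {3, 4, 5} \<Longrightarrow> h$i$j = 0"
    and "i \<in> {1, 2, 6, 7} \<Longrightarrow> j \<in> {3, 4, 5} \<Longrightarrow> h$j$i = 0"
  using assms by (auto simp: phi_SL2_def phi_def)

lemma x_root_simple_products:
  "x_root (1, 1) 1 ** x_root (0, -1) 1 =
     (vec7 (vec7 1 1 1 0 0 0 0) (vec7 0 1 0 (-2) (-1) (-1) 0) (vec7 0 1 1 0 0 0 0)
       (vec7 0 0 0 1 1 1 0) (vec7 0 0 0 0 1 0 (-1)) (vec7 0 0 0 0 1 1 0) (vec7 0 0 0 0 0 0 1)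
       :: 'k::field^7^7)"
  "x_root (0, 1) 1 ** x_root (0, -1) 1 ** x_root (-2, -1) 1 =
     (vec7 (vec7 1 0 0 0 0 0 0) (vec7 0 2 1 0 0 0 0) (vec7 0 1 1 0 0 0 0)
       (vec7 (-1) 0 0 1 0 0 0) (vec7 0 2 1 0 2 1 0) (vec7 0 1 1 0 1 1 0) (vec7 1 0 0 (-2) 0 0 1)
       :: 'k::field^7^7)"
  by (simp_all add: x_root_eq g2_roots_def, simp_all add: chev_e_def munit_calc)
    (simp_all add: vec_eq_iff forall_7 matrix_matrix_mult_def sum_7 munit_def)

text \<open>
  The conclusion already follows from the vanishing of the blocks between \<open>W3\<close> and \<open>W4\<close> in the
  conjugate of \<open>phi A B\<close>. In terms of the entries of \<open>A\<close> and \<open>B\<close>, the seven equations chosen from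
  it first kill the lower left entries, then make the diagonal entries equal, and then kill
  the upper right entries. The last step divides by 4.
\<close>
lemma separating_odd:
  fixes h :: "'k::field^7^7"
  assumes two: "(2 :: 'k) \<noteq> 0"
    and g: "g = x_root (1, 1) 1 ** x_root (0, -1) 1" and inv: "g ** g' = mat 1"
    and h: "h \<in> phi_SL2" and conj: "g ** h ** g' \<in> phi_SL2"
  shows "h = mat 1"
proof -
  have "g' = vec7 (vec7 1 0 (-1) 0 0 0 0) (vec7 0 1 0 2 0 (-1) 0) (vec7 0 (-1) 1 (-2) 0 1 0)
     (vec7 0 0 0 1 0 (-1) 0) (vec7 0 0 0 0 1 0 1) (vec7 0 0 0 0 (-1) 1 (-1)) (vec7 0 0 0 0 0 0 1)"
    (is "g' = ?g'")
  proof -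
    have "?g' ** g = mat 1"
      unfolding g x_root_simple_products
      by (simp add: vec_eq_iff forall_7 matrix_matrix_mult_def sum_7) (simp add: mat_def)
    then have "g' = ?g' ** (g ** g')" by (simp only: matrix_mul_assoc matrix_mul_lid)
    then show ?thesis by (simp only: inv matrix_mul_rid)
  qed
  obtain A B where AB: "h = phi A B" "det A = 1" "det B = 1" using h by (auto simp: phi_SL2_def)
  obtain a b c d where A: "A = mat2 a b c d" by (rule mat2_cases)
  obtain e f u v where B: "B = mat2 e f u v" by (rule mat2_cases)
  have det: "a * d - b * c = 1" "e * v - f * u = 1" using AB by (simp_all add: A B det_mat2)
  note entry = phi_SL2_block[OF conj, unfolded g x_root_simple_products \<open>g' = ?g'\<close> AB(1) A B phi_mat2]
  have eqs: "a * u = 0" "c * e = 0" "c * u = 0" "a * v = e * e" "a * e + a * u = e * e"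
      "b * e + b * u + f * f = 0" "2 * (a * f) + 2 * (a * v) - 2 * (e * e) + 2 * (e * f) = 0"
    using entry(2)[of 1 3] entry(2)[of 1 4] entry(2)[of 1 5] entry(2)[of 2 3]
      entry(1)[of 1 3] entry(1)[of 1 5] entry(1)[of 1 4]
    by (simp_all only: matrix_matrix_mult_def sum_7 vec_lambda_beta vec7_nth)
      (simp_all add: algebra_simps power2_eq_square)
  have "u = (a * d - b * c) * u" by (simp add: det)
  also have "\<dots> = d * (a * u) - b * (c * u)" by (simp add: algebra_simps)
  finally have u: "u = 0" by (simp add: eqs)
  then have ev: "e * v = 1" using det by simp
  then have "e \<noteq> 0" by auto
  then have c: "c = 0" using eqs by simp
  have ae: "a = e" using eqs u \<open>e \<noteq> 0\<close> by simp
  then have ve: "v = e" using eqs \<open>e \<noteq> 0\<close> by simp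
  have "e * d = e * e" using det c ae ev ve by simp
  then have de: "d = e" using \<open>e \<noteq> 0\<close> by simp
  have "2 * 2 * (e * f) = 0" using eqs(7) by (simp add: ae ve)
  then have f: "f = 0" using two \<open>e \<noteq> 0\<close> by (metis mult_eq_0_iff)
  then have b: "b = 0" using eqs(6) u \<open>e \<noteq> 0\<close> by simp
  show ?thesis
    using ev by (simp add: AB A B ae ve de f b u c phi_mat2 vec_eq_iff forall_7 power2_eq_square)
      (simp add: mat_def)
qed

text \<open>
  The same method in characteristic 2. Here \<open>B\<close> loses its upper right entry at once, since the
  square of this entry vanishes, and the diagonal entries satisfy \<open>v^2 = e^2\<close>, which gives
  \<open>v = e\<close> by injectivity of squaring. In odd characteristic \<open>v = -e\<close> would be left over.
\<close>
lemma separating_even: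
  fixes h :: "'k::field^7^7"
  assumes two: "(2 :: 'k) = 0"
    and g: "g = x_root (0, 1) 1 ** x_root (0, -1) 1 ** x_root (-2, -1) 1" and inv: "g ** g' = mat 1"
    and h: "h \<in> phi_SL2" and conj: "g ** h ** g' \<in> phi_SL2"
  shows "h = mat 1"
proof -
  have "g' = vec7 (vec7 1 0 0 0 0 0 0) (vec7 0 1 (-1) 0 0 0 0) (vec7 0 (-1) 2 0 0 0 0)
     (vec7 1 0 0 1 0 0 0) (vec7 0 (-1) 1 0 1 (-1) 0) (vec7 0 1 (-2) 0 (-1) 2 0) (vec7 1 0 0 2 0 0 1)"
    (is "g' = ?g'")
  proof -
    have "?g' ** g = mat 1"
      unfolding g x_root_simple_products
      by (simp add: vec_eq_iff forall_7 matrix_matrix_mult_def sum_7) (simp add: mat_def)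
    then have "g' = ?g' ** (g ** g')" by (simp only: matrix_mul_assoc matrix_mul_lid)
    then show ?thesis by (simp only: inv matrix_mul_rid)
  qed
  obtain A B where AB: "h = phi A B" "det A = 1" "det B = 1" using h by (auto simp: phi_SL2_def)
  obtain a b c d where A: "A = mat2 a b c d" by (rule mat2_cases)
  obtain e f u v where B: "B = mat2 e f u v" by (rule mat2_cases)
  have det: "a * d - b * c = 1" "e * v - f * u = 1" using AB by (simp_all add: A B det_mat2)
  note entry = phi_SL2_block[OF conj, unfolded g x_root_simple_products \<open>g' = ?g'\<close> AB(1) A B phi_mat2]
  have eqs: "2 * (b * u) + f * f = 0" "b * e = 0" "b * v = 0" "a * u - b * v + 2 * (e * f) = 0"
      "2 * (a * u) - 2 * (b * v) - c * e + d * f + 2 * (e * f) + 4 * (u * v) = 0"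
      "a * v - b * u - e * e - f * f = 0" "- (a * e) + b * f + e * v + f * u = 0"
      "b * u - d * e + f * f + v * v = 0"
    using entry(1)[of 2 5] entry(1)[of 1 5] entry(2)[of 7 3] entry(2)[of 1 3]
      entry(2)[of 1 5] entry(2)[of 2 3] entry(2)[of 1 4] entry(1)[of 6 5]
    by (simp_all only: matrix_matrix_mult_def sum_7 vec_lambda_beta vec7_nth)
      (simp_all add: algebra_simps power2_eq_square)
  have f: "f = 0" using eqs(1) two by simp
  then have ev: "e * v = 1" using det by simp
  then have "e \<noteq> 0" by auto
  then have b: "b = 0" using eqs by simp
  then have ad: "a * d = 1" using det by simp
  then have u: "u = 0" using eqs(4) by (auto simp: f b)
  then have c: "c = 0" using eqs(5) \<open>e \<noteq> 0\<close> by (simp add: f b)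
  have "v * e = a * e" using eqs(7) by (simp add: f b u mult.commute)
  then have av: "a = v" using \<open>e \<noteq> 0\<close> by simp
  have "(v - e)^2 = v * v - e * e - 2 * (v * e) + 2 * (e * e)" by (simp add: power2_eq_square algebra_simps)
  also have "\<dots> = 0" using eqs(6) by (simp add: f b av two)
  finally have ve: "v = e" by simp
  have "e * d = e * e" using ad ev by (simp add: av ve)
  then have de: "d = e" using \<open>e \<noteq> 0\<close> by simp
  show ?thesis
    using ev by (simp add: AB A B av ve de f b u c phi_mat2 vec_eq_iff forall_7 power2_eq_square)
      (simp add: mat_def)
qed

text \<open>The products are fixed by \<open>\<sigma>\<close>, since \<open>\<sigma>\<close> maps \<open>x_r(1)\<close> to \<open>x_r(1^q)\<close>.\<close>
lemma separating_element:
  assumes prime: "prime CHAR('k::field)" and q: "q = CHAR('k) ^ n"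
  obtains g :: "'k::field^7^7" where "g \<in> G2_bar" "frob q g = g"
    "\<forall>h\<in>phi_SL2. \<forall>g'. g ** g' = mat 1 \<longrightarrow> g ** h ** g' \<in> phi_SL2 \<longrightarrow> h = mat 1"
proof -
  interpret G2_bar: subgroup "G2_bar :: ('k^7^7) set" GL by (rule subgroup_G2_bar)
  have gen: "x_root r 1 \<in> (G2_bar :: ('k^7^7) set)" "frob q (x_root r 1 :: 'k^7^7) = x_root r 1"
    if "r \<in> g2_roots" for r
    using that by (auto simp: G2_bar_def frob_x_root[OF prime q] intro: generate.incl)
  have mult: "A ** B \<in> G2_bar" if "A \<in> G2_bar" "B \<in> G2_bar" for A B :: "'k^7^7"
    using G2_bar.m_closed[OF that] by simp
  show ?thesis
  proof (cases "(2 :: 'k) = 0")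
    case True
    show ?thesis
      using separating_even[OF True refl]
      by (intro that[of "x_root (0, 1) 1 ** x_root (0, -1) 1 ** x_root (-2, -1) 1"])
        (auto intro!: mult gen simp: frob_mult[OF prime q] gen g2_roots_def)
  next
    case False
    show ?thesis
      using separating_odd[OF False refl]
      by (intro that[of "x_root (1, 1) 1 ** x_root (0, -1) 1"])
        (auto intro!: mult gen simp: frob_mult[OF prime q] gen g2_roots_def)
  qed
qed

section \<open>The base size\<close>

lemma (in group) base_size_eq_2:
  assumes H: "subgroup H G" "H \<noteq> {\<one>}" and s: "s \<in> carrier G"
    and trivial: "H \<inter> conjugate_set G H s \<subseteq> {\<one>}"
  shows "base_size G H = 2"
proof -
  interpret H: subgroup H G by (rule H)
  obtain h where h: "h \<in> H" "h \<noteq> \<one>" using H H.one_closed by blast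
  have one: "\<one> \<in> conjugate_set G H t" if "t \<in> carrier G" for t
    using that H.one_closed unfolding conjugate_set_def by (intro image_eqI[of _ _ \<one>]) auto
  have self: "conjugate_set G H \<one> = H"
  proof -
    have "inv \<one> \<otimes> k \<otimes> \<one> = k" if "k \<in> H" for k using that by simp
    then show ?thesis unfolding conjugate_set_def by simp
  qed
  have pair: "conj_Inter G H S = {\<one>}" if "{\<one>, s} \<subseteq> S" "S \<subseteq> carrier G" for S
  proof
    have "conj_Inter G H S \<subseteq> conjugate_set G H \<one> \<inter> conjugate_set G H s"
      using that unfolding conj_Inter_def by blast
    then show "conj_Inter G H S \<subseteq> {\<one>}" using trivial self by blast
    show "{\<one>} \<subseteq> conj_Inter G H S" using one that unfolding conj_Inter_def by blast
  qed
  have core: "conj_Inter G H (carrier G) = {\<one>}" using pair[of "carrier G"] s by simp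
  have "s \<noteq> \<one>" using trivial h self by auto
  then have two: "{\<one>, s} \<subseteq> carrier G \<and> finite {\<one>, s} \<and> card {\<one>, s} = 2 \<and>
      conj_Inter G H {\<one>, s} = conj_Inter G H (carrier G)"
    using pair[of "{\<one>, s}"] s core by simp
  have few: "conj_Inter G H S \<noteq> {\<one>}" if S: "S \<subseteq> carrier G" "finite S" "card S < 2" for S
  proof -
    have "card S = 0 \<or> card S = 1" using S(3) by linarith
    then consider "S = {}" | t where "S = {t}" using S(2) by (auto simp: card_1_singleton_iff)
    then show ?thesis
    proof cases
      case 1
      then show ?thesis using h H.subset by (auto simp: conj_Inter_def)
    next
      case 2
      then have t: "t \<in> carrier G" using S(1) by simp
      have "inv t \<otimes> h \<otimes> t \<in> conj_Inter G H S"
        using h t H.subset unfolding 2 conj_Inter_def conjugate_set_def by auto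
      moreover have "inv t \<otimes> h \<otimes> t \<noteq> \<one>"
      proof
        assume "inv t \<otimes> h \<otimes> t = \<one>"
        then have "t \<otimes> (inv t \<otimes> h \<otimes> t) \<otimes> inv t = \<one>" using t by simp
        then show False using h t H.subset by (simp add: m_assoc subset_iff) (simp flip: m_assoc)
      qed
      ultimately show ?thesis by auto
    qed
  qed
  show ?thesis
    unfolding base_size_def
  proof (rule Least_equality)
    show "\<exists>S. S \<subseteq> carrier G \<and> finite S \<and> card S = 2 \<and> conj_Inter G H S = conj_Inter G H (carrier G)"
      using two by blast
    show "2 \<le> m" if "\<exists>S. S \<subseteq> carrier G \<and> finite S \<and> card S = m \<and>
        conj_Inter G H S = conj_Inter G H (carrier G)" for m
      using that few core by (metis not_le)
  qed
qed

theorem lemma5p7: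
  fixes p n q :: nat and H :: "('k::alg_closed_field^7^7) set"
  assumes "prime p" and "n \<ge> 1" and "q = p ^ n" and "q \<ge> 3"
    and "CHAR('k) = p" and "\<And>x :: 'k. algebraic_over_Fq q x"
    and "max_rank_A1A1 q H" and "maximal_subgroup H (G2 q)"
  shows "base_size (G2 q) H = 2"
proof -
  have prime: "prime CHAR('k)" and q: "q = CHAR('k) ^ n" using assms by auto
  interpret GL: group "GL :: ('k^7^7) monoid" by (rule group_GL)
  interpret G2: group "G2 q :: ('k^7^7) monoid" by (rule group_G2[OF prime q])
  let ?F = "{g \<in> G2_bar. frob q g = (g :: 'k^7^7)}"
  interpret F: subgroup ?F GL by (rule subgroup_fixed_points[OF prime q])
  have G2_simps: "carrier (G2 q) = ?F" "\<And>x y. x \<otimes>\<^bsub>G2 q\<^esub> y = x ** y" "\<one>\<^bsub>G2 q\<^esub> = (mat 1 :: 'k^7^7)"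
    by (simp_all add: G2_def)
  have G2_inv: "inv\<^bsub>G2 q\<^esub> x = inv\<^bsub>GL\<^esub> x" if "x \<in> ?F" for x
    unfolding G2_def by (rule GL.m_inv_consistent[OF subgroup_fixed_points[OF prime q] that])
  obtain x where x: "x \<in> ?F" and H: "H = {h \<in> conjugate_set GL phi_SL2 x. frob q h = h}"
    using max_rank_A1A1_conjugate[OF prime q assms(2,7)] by blast
  obtain g :: "'k^7^7" where g: "g \<in> G2_bar" "frob q g = g"
    and sep: "\<forall>h\<in>phi_SL2. \<forall>g'. g ** g' = mat 1 \<longrightarrow> g ** h ** g' \<in> phi_SL2 \<longrightarrow> h = mat 1"
    by (rule separating_element[OF prime q])
  then have g: "g \<in> ?F" by simp
  define x' where "x' = inv\<^bsub>GL\<^esub> x"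
  define g' where "g' = inv\<^bsub>GL\<^esub> g"
  have F: "x' \<in> ?F" "g' \<in> ?F" unfolding x'_def g'_def by (rule F.m_inv_closed[OF x], rule F.m_inv_closed[OF g])
  have F_mult: "A ** B \<in> ?F" if "A \<in> ?F" "B \<in> ?F" for A B using F.m_closed[OF that] by simp
  have cancel: "x ** x' = mat 1" "x' ** x = mat 1" "g ** g' = mat 1" "g' ** g = mat 1"
    using GL.r_inv[of x] GL.l_inv[of x] GL.r_inv[of g] GL.l_inv[of g] F.subset x g
    by (auto simp: x'_def g'_def)
  define s where "s = x' ** g ** x"
  define s' where "s' = x' ** g' ** x"
  have s: "s \<in> ?F" unfolding s_def by (intro F_mult F x g)
  have "s ** s' = x' ** (g ** (x ** x') ** g') ** x" by (simp add: s_def s'_def matrix_mul_assoc)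
  then have ss': "s ** s' = mat 1" by (simp add: cancel)
  show ?thesis
  proof (rule G2.base_size_eq_2)
    show "subgroup H (G2 q)" using assms(8) by (simp add: maximal_subgroup_def)
    show "s \<in> carrier (G2 q)" using s by (simp add: G2_simps)
    show "H \<inter> conjugate_set (G2 q) H s \<subseteq> {\<one>\<^bsub>G2 q\<^esub>}"
    proof
      fix z assume z: "z \<in> H \<inter> conjugate_set (G2 q) H s"
      then obtain h where h: "h \<in> phi_SL2" "z = x' ** h ** x"
        by (auto simp: H conjugate_set_def x'_def)
      obtain k where k: "k \<in> phi_SL2" "z = s' ** (x' ** k ** x) ** s"
        using z s by (auto simp: H conjugate_set_def G2_simps G2_inv inv_GL_eq[OF ss'] x'_def)
      have "g ** (x ** x') ** h ** (x ** x') ** g' = g ** x ** z ** x' ** g'"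
        by (simp only: h(2) matrix_mul_assoc)
      also have "\<dots> = (g ** (x ** x') ** g') ** (x ** x') ** k ** (x ** x') ** (g ** (x ** x') ** g')"
        by (simp only: k(2) s_def s'_def matrix_mul_assoc)
      finally have "g ** h ** g' = k" by (simp add: cancel)
      then have "h = mat 1" using sep cancel(3) h(1) k(1) by blast
      then show "z \<in> {\<one>\<^bsub>G2 q\<^esub>}" by (simp add: h cancel G2_simps)
    qed
    show "H \<noteq> {\<one>\<^bsub>G2 q\<^esub>}"
    proof
      assume H1: "H = {\<one>\<^bsub>G2 q\<^esub>}"
      let ?r = "x_root (1, 0) 1 :: 'k^7^7"
      have r: "?r \<in> phi_SL2" "frob q ?r = ?r"
        by (auto simp: x_root_phi det_mat2 intro!: phi_SL2_I) (simp add: frob_x_root[OF prime q] flip: x_root_phi)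
      have "x' ** ?r ** x \<in> H"
        using r F(1) x by (auto simp: H conjugate_set_def x'_def frob_mult[OF prime q])
      then have "x' ** ?r ** x = mat 1" using H1 by (simp add: G2_simps)
      then have "x ** (x' ** ?r ** x) ** x' = mat 1" by (simp add: cancel)
      moreover have "x ** (x' ** ?r ** x) ** x' = (x ** x') ** ?r ** (x ** x')" by (simp only: matrix_mul_assoc)
      ultimately have "?r = mat 1" by (simp add: cancel)
      then have "?r $ 1 $ 2 = (mat 1 :: 'k^7^7) $ 1 $ 2" by (rule arg_cong)
      then show False by (simp add: x_root_phi mat_1_eq_mat2 phi_mat2) (simp add: mat_def)
    qed
  qed
qed

end
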